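(* Assume that conditions (C1), (C2) and (C3) stated in the context hold. Let $\mathcal{C}\subset[J]$ be nonempty and $\Theta\subset\operatorname{dom}(\Lambda)$ be a finite set. If $\{\beta^j:j\in\mathcal{C}\}\subset\Theta$, then $$\lim_{b\to\infty}\frac1b\log\mathbb{E}_\Theta\left[\left(\widehat{\mathbb{W}}_b(\Theta)\right)^2\sum_{j\in\mathcal{C}}\mathbf 1\{\tau_b^*=\tau_b^j\}\right]=-2r_{\mathcal{C}},\qquad r_{\mathcal{C}}:=\min_{j\in\mathcal{C}}r_j.$$ Consequently, if $\{\beta^j:j\in[J]\}\subset\Theta$, then $$\limsup_{b\to\infty}\frac1b\log\mathbb{E}_\Theta\left[\left(\widehat{\mathbb{W}}_b(\Theta)\right)^2\right]\le-2r_*,$$ and as a result $\mathbb{P}_\Theta$ is an asymptotically efficient proposal for estimating the wrong exit probability $\mathbb{P}(\tau_b^*<\tau_b^0)$.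
   Context: $X_1,X_2,\ldots$ are i.i.d. $\mathbb{R}^d$-valued random vectors on a probability space $(\Omega,\mathcal{F},\mathbb{P})$, $S_0=0$, $S_n=\sum_{i=1}^nX_i$, $\mathcal{F}_n=\sigma(X_1,\ldots,X_n)$ ($\mathcal{F}_0$ trivial). For $\theta,x\in\mathbb{R}^d$: $\Lambda(\theta)=\log\mathbb{E}[e^{\theta\cdot X_1}]\in(-\infty,\infty]$, $\Lambda^*(x)=\sup_{\theta\in\mathbb{R}^d}\{\theta\cdot x-\Lambda(\theta)\}$, $I(x)=\sup\{\theta\cdot x:\Lambda(\theta)\le 0\}$. For a function $f$, $\operatorname{dom}(f)=\{f<\infty\}$; $\operatorname{cone}(A)=\{\lambda x:\lambda>0,x\in A\}$; $B(x,r)$ is the open Euclidean ball; $[J]=\{1,\ldots,J\}$. $W^1,\ldots,W^J\subset\mathbb{R}^d$ are open convex sets and $W^0\subset\mathbb{R}^d$ is an open set (not necessarily convex, possibly empty). For $b>0$, $\tau_b^j=\inf\{n\ge0:S_n\in bW^j\}$ for $j=0,1,\ldots,J$ (with $\inf\emptyset=\infty$), $\tau_b^*=\min_{j\in[J]}\tau_b^j$. For $j\in[J]$, $r_j=\inf_{x\in W^j}I(x)$; $r_*=\min_{j\in[J]}r_j$. (C1) There is $\delta>0$ such that $\operatorname{cone}(B(\mathbb{E}[X_1],\delta))\cap W^j=\emptyset$ for every $j\in[J]$. (C2) $\operatorname{dom}(\Lambda)$ is open, and $\operatorname{int}(\operatorname{cone}(\operatorname{dom}(\Lambda^* )))\cap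 W^j\neq\emptyset$ for every $j\in[J]$. (C3) $\operatorname{cone}(W^j)\cap\operatorname{cone}(W^{j'})=\emptyset$ for all $0\le j\ne j'\le J$, and there is $\delta>0$ such that $B(\mathbf 0,\delta)\cap W^j=\emptyset$ for each $j\in\{0\}\cup[J]$. Under (C1)–(C2), for each $j\in[J]$ there is a unique $\beta^j\in\mathbb{R}^d$ (the optimal tilting associated with $W^j$) with $\Lambda(\beta^j)=0$, $W^j\subset\{v:\beta^j\cdot v\ge r_j\}$ and $\{x:I(x)\le r_j\}\subset\{v:\beta^j\cdot v\le r_j\}$ (known result of Collamore). For $\theta\in\operatorname{dom}(\Lambda)$, $\mathbb{P}_\theta$ is the probability measure with $\frac{d\mathbb{P}_\theta}{d\mathbb{P}}(\mathcal{F}_n)=\exp(\theta\cdot S_n-n\Lambda(\theta))$ for all $n$. For a finite $\Theta\subset\operatorname{dom}(\Lambda)$, $\mathbb{P}_\Theta=\frac1{|\Theta|}\sum_{\theta\in\Theta}\mathbb{P}_\theta$ with expectation $\mathbb{E}_\Theta$. For a stopping time $T$, $\mathbb{L}_\theta(T)=\exp(\theta\cdot S_T-T\Lambda(\theta))\mathbf 1\{T<\infty\}$, and $$\widehat{\mathbb{W}}_b(\Theta)=\Big(\frac1{|\Theta|}\sum_{\theta\in\Theta}\mathbb{L}_\theta(\tau_b^* )\Big)^{-1}\mathbf 1\{\tau_b^*<\tau_b^0\}$$ (equal to $0$ off the event $\{\tau_b^*<\tau_b^0\}$). $\mathbb{P}_\Theta$ is called asymptotically efficient for estimating $\mathbb{P}(\tau_b^*<\tau_b^0)$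 if $\log\mathbb{E}_\Theta[(\widehat{\mathbb{W}}_b(\Theta))^2]\big/\big(2\log\mathbb{P}(\tau_b^*<\tau_b^0)\big)\to1$ as $b\to\infty$. *)

theory Defs
  imports "HOL-Probability.Probability"
begin

definition elog :: "ennreal \<Rightarrow> ereal" where
  "elog x = (if x = 0 then - \<infinity> else if x = \<infinity> then \<infinity> else ereal (ln (enn2real x)))"

text \<open>Unlike \<open>cone hull\<close> and \<open>conic hull\<close>, only strictly positive scalars are used.\<close>

definition pos_cone :: "'a::real_vector set \<Rightarrow> 'a set" where
  "pos_cone A = {c *\<^sub>R x | c x. c > 0 \<and> x \<in> A}"

definition edom :: "('a \<Rightarrow> ereal) \<Rightarrow> 'a set" where
  "edom f = {x. f x < \<infinity>}"


subsection \<open>Cumulant generating function and rate functions\<close>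

definition cgf :: "'w measure \<Rightarrow> ('w \<Rightarrow> 'a::euclidean_space) \<Rightarrow> 'a \<Rightarrow> ereal" where
  "cgf M Y \<theta> = elog (\<integral>\<^sup>+\<omega>. ennreal (exp (\<theta> \<bullet> Y \<omega>)) \<partial>M)"

definition legendre :: "('a::euclidean_space \<Rightarrow> ereal) \<Rightarrow> 'a \<Rightarrow> ereal" where
  "legendre \<Lambda> x = (SUP \<theta>. ereal (\<theta> \<bullet> x) - \<Lambda> \<theta>)"

definition rate :: "('a::euclidean_space \<Rightarrow> ereal) \<Rightarrow> 'a \<Rightarrow> ereal" where
  "rate \<Lambda> x = Sup {ereal (\<theta> \<bullet> x) | \<theta>. \<Lambda> \<theta> \<le> 0}"

definition set_rate :: "('a::euclidean_space \<Rightarrow> ereal) \<Rightarrow> 'a set \<Rightarrow> ereal" where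
  "set_rate \<Lambda> A = (INF x\<in>A. rate \<Lambda> x)"

definition optimal_tilting :: "('a::euclidean_space \<Rightarrow> ereal) \<Rightarrow> 'a set \<Rightarrow> 'a \<Rightarrow> bool" where
  "optimal_tilting \<Lambda> A \<beta> \<longleftrightarrow>
     \<Lambda> \<beta> = 0 \<and>
     A \<subseteq> {v. ereal (\<beta> \<bullet> v) \<ge> set_rate \<Lambda> A} \<and>
     {x. rate \<Lambda> x \<le> set_rate \<Lambda> A} \<subseteq> {v. ereal (\<beta> \<bullet> v) \<le> set_rate \<Lambda> A}"


subsection \<open>Random walk and hitting times\<close>

text \<open>The increments are \<open>X 1, X 2, \<dots>\<close>; the value \<open>X 0\<close> is never used.\<close>

definition walk :: "(nat \<Rightarrow> 'w \<Rightarrow> 'a::real_vector) \<Rightarrow> nat \<Rightarrow> 'w \<Rightarrow> 'a" where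
  "walk X n \<omega> = (\<Sum>i=1..n. X i \<omega>)"

definition nat_filtration ::
  "'w measure \<Rightarrow> (nat \<Rightarrow> 'w \<Rightarrow> 'a::topological_space) \<Rightarrow> nat \<Rightarrow> 'w measure" where
  "nat_filtration M X n =
     sigma (space M) (\<Union>i\<in>{1..n}. {X i -` A \<inter> space M | A. A \<in> sets borel})"

text \<open>In \<^typ>\<open>enat\<close> the infimum of the empty set is \<open>\<infinity>\<close>.\<close>

definition hit ::
  "(nat \<Rightarrow> 'w \<Rightarrow> 'a::real_vector) \<Rightarrow> (nat \<Rightarrow> 'a set) \<Rightarrow> real \<Rightarrow> nat \<Rightarrow> 'w \<Rightarrow> enat" where
  "hit X W b j \<omega> = Inf {enat n | n. walk X n \<omega> \<in> (\<lambda>x. b *\<^sub>R x) ` W j}"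

definition first_hit ::
  "(nat \<Rightarrow> 'w \<Rightarrow> 'a::real_vector) \<Rightarrow> (nat \<Rightarrow> 'a set) \<Rightarrow> nat \<Rightarrow> real \<Rightarrow> 'w \<Rightarrow> enat" where
  "first_hit X W J b \<omega> = (MIN j\<in>{1..J}. hit X W b j \<omega>)"


subsection \<open>Exponential tilting\<close>

text \<open>The likelihood ratio at time \<open>n\<close>. It is meant for \<open>\<theta>\<close> in the effective domain of
  the cumulant generating function, where \<^const>\<open>real_of_ereal\<close> loses nothing.\<close>

definition lr ::
  "'w measure \<Rightarrow> (nat \<Rightarrow> 'w \<Rightarrow> 'a::euclidean_space) \<Rightarrow> 'a \<Rightarrow> nat \<Rightarrow> 'w \<Rightarrow> real" where
  "lr M X \<theta> n \<omega> =
     exp (\<theta> \<bullet> walk X n \<omega> - real n * real_of_ereal (cgf M (X 1) \<theta>))"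

definition stopped_lr ::
  "'w measure \<Rightarrow> (nat \<Rightarrow> 'w \<Rightarrow> 'a::euclidean_space) \<Rightarrow> 'a \<Rightarrow> ('w \<Rightarrow> enat) \<Rightarrow> 'w \<Rightarrow> real" where
  "stopped_lr M X \<theta> T \<omega> = (if T \<omega> < \<infinity> then lr M X \<theta> (the_enat (T \<omega>)) \<omega> else 0)"

text \<open>\<open>N\<close> is a probability measure on the same measurable space as \<open>M\<close> whose
  Radon-Nikodym derivative with respect to \<open>M\<close> on the \<open>\<sigma>\<close>-algebra of the first \<open>n\<close>
  increments is the likelihood ratio, for every \<open>n\<close>. This determines \<open>N\<close> on the
  \<open>\<sigma>\<close>-algebra generated by all increments. Existence is a matter of the underlying
  space (it holds on the canonical one), so tilted measures are characterised by
  a predicate.\<close>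

definition tilted_measure ::
  "'w measure \<Rightarrow> (nat \<Rightarrow> 'w \<Rightarrow> 'a::euclidean_space) \<Rightarrow> 'a \<Rightarrow> 'w measure \<Rightarrow> bool" where
  "tilted_measure M X \<theta> N \<longleftrightarrow>
     prob_space N \<and> space N = space M \<and> sets N = sets M \<and>
     (\<forall>n. \<forall>A\<in>sets (nat_filtration M X n).
        emeasure N A = (\<integral>\<^sup>+\<omega>\<in>A. ennreal (lr M X \<theta> n \<omega>) \<partial>M))"

definition mixture :: "'w measure \<Rightarrow> ('a \<Rightarrow> 'w measure) \<Rightarrow> 'a set \<Rightarrow> 'w measure" where
  "mixture M Q \<Theta> =
     measure_of (space M) (sets M) (\<lambda>A. (\<Sum>\<theta>\<in>\<Theta>. emeasure (Q \<theta>) A) / of_nat (card \<Theta>))"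

lemma space_mixture [simp]: "space (mixture M Q \<Theta>) = space M"
  and sets_mixture [simp, measurable_cong]: "sets (mixture M Q \<Theta>) = sets M"
  by (simp_all add: mixture_def)

lemma emeasure_mixture:
  assumes Q: "\<And>\<theta>. \<theta> \<in> \<Theta> \<Longrightarrow> sets (Q \<theta>) = sets M" and A: "A \<in> sets M"
  shows "emeasure (mixture M Q \<Theta>) A = (\<Sum>\<theta>\<in>\<Theta>. emeasure (Q \<theta>) A) / of_nat (card \<Theta>)"
  unfolding mixture_def
proof (rule emeasure_measure_of_sigma[OF sets.sigma_algebra_axioms _ _ A])
  show "positive (sets M) (\<lambda>A. (\<Sum>\<theta>\<in>\<Theta>. emeasure (Q \<theta>) A) / of_nat (card \<Theta>))"
    by (simp add: positive_def)
  show "countably_additive (sets M) (\<lambda>A. (\<Sum>\<theta>\<in>\<Theta>. emeasure (Q \<theta>) A) / of_nat (card \<Theta>))"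
  proof (rule countably_additiveI)
    fix F :: "nat \<Rightarrow> _" assume F: "range F \<subseteq> sets M" "disjoint_family F"
    have "(\<Sum>i. (\<Sum>\<theta>\<in>\<Theta>. emeasure (Q \<theta>) (F i)) / of_nat (card \<Theta>))
        = (\<Sum>i. \<Sum>\<theta>\<in>\<Theta>. emeasure (Q \<theta>) (F i)) / of_nat (card \<Theta>)"
      by (simp add: divide_ennreal_def ennreal_suminf_multc)
    also have "(\<Sum>i. \<Sum>\<theta>\<in>\<Theta>. emeasure (Q \<theta>) (F i)) = (\<Sum>\<theta>\<in>\<Theta>. \<Sum>i. emeasure (Q \<theta>) (F i))"
      by (rule suminf_sum) simp
    also have "\<dots> = (\<Sum>\<theta>\<in>\<Theta>. emeasure (Q \<theta>) (\<Union>i. F i))"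
      using F Q by (intro sum.cong suminf_emeasure) auto
    finally show "(\<Sum>i. (\<Sum>\<theta>\<in>\<Theta>. emeasure (Q \<theta>) (F i)) / of_nat (card \<Theta>))
        = (\<Sum>\<theta>\<in>\<Theta>. emeasure (Q \<theta>) (\<Union>i. F i)) / of_nat (card \<Theta>)" .
  qed
qed


subsection \<open>Importance sampling of the wrong exit probability\<close>

definition wrong_exit ::
  "'w measure \<Rightarrow> (nat \<Rightarrow> 'w \<Rightarrow> 'a::euclidean_space) \<Rightarrow> (nat \<Rightarrow> 'a set) \<Rightarrow> nat \<Rightarrow> real \<Rightarrow> 'w set"
  where "wrong_exit M X W J b = {\<omega> \<in> space M. first_hit X W J b \<omega> < hit X W b 0 \<omega>}"

definition IS_weight ::
  "'w measure \<Rightarrow> (nat \<Rightarrow> 'w \<Rightarrow> 'a::euclidean_space) \<Rightarrow> (nat \<Rightarrow> 'a set) \<Rightarrow> nat \<Rightarrow> 'a set \<Rightarrow>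
    real \<Rightarrow> 'w \<Rightarrow> real" where
  "IS_weight M X W J \<Theta> b \<omega> =
     inverse (1 / real (card \<Theta>) * (\<Sum>\<theta>\<in>\<Theta>. stopped_lr M X \<theta> (first_hit X W J b) \<omega>)) *
     of_bool (first_hit X W J b \<omega> < hit X W b 0 \<omega>)"

text \<open>The quotient is formed in \<^typ>\<open>ereal\<close>. The conventions for degenerate quotients only
  produce the values \<open>0\<close> and \<open>\<plusminus>\<infinity>\<close>, so convergence to \<open>1\<close> forces both logarithms to be
  finite and nonzero for all large \<open>b\<close>.\<close>

definition asymptotically_efficient ::
  "'w measure \<Rightarrow> (nat \<Rightarrow> 'w \<Rightarrow> 'a::euclidean_space) \<Rightarrow> (nat \<Rightarrow> 'a set) \<Rightarrow> nat \<Rightarrow>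
    ('a \<Rightarrow> 'w measure) \<Rightarrow> 'a set \<Rightarrow> bool" where
  "asymptotically_efficient M X W J Q \<Theta> \<longleftrightarrow>
     ((\<lambda>b. elog (\<integral>\<^sup>+\<omega>. ennreal ((IS_weight M X W J \<Theta> b \<omega>)\<^sup>2) \<partial>mixture M Q \<Theta>) /
           (2 * elog (emeasure M (wrong_exit M X W J b)))) \<longlongrightarrow> 1) at_top"

end

theory Submission
  imports Defs
begin

text \<open>
  Upper bound: if the walk exits through \<open>b W\<^sup>j\<close> and \<open>\<beta>\<^sup>j \<in> \<Theta>\<close>, then \<open>\<beta>\<^sup>j \<bullet> S\<^sub>\<tau> \<ge> b r\<^sub>j\<close>, so the
  weight is at most \<open>|\<Theta>| exp (- b r\<^sub>j)\<close> pointwise.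

  Lower bound: the weight is unbiased, so by Cauchy--Schwarz the second moment dominates the square
  of the exit probability. For a nearly optimal \<open>x \<in> W\<^sup>j\<close> a maximiser \<open>\<theta>\<close> of \<open>\<theta> \<bullet> x\<close> over
  \<open>\<Lambda> \<le> 0\<close> exists, because \<open>W\<^sup>j\<close> meets the interior of the cone over the domain of \<open>\<Lambda>\<^sup>*\<close>, and by
  Lagrange \<open>x\<close> is a multiple of the drift under the tilting by \<open>\<theta>\<close>. A Chernoff and union bound
  keeps the tilted walk in a tube around the ray through \<open>x\<close>, and disjointness of the cones makes
  it enter \<open>b W\<^sup>j\<close> before any other target set. No process is constructed under the tilted law: all
  expectations are exponential moments under the original measure.

  For efficiency one also needs \<open>r\<^sub>* > 0\<close>. This follows from the separation of the targets from the
  mean direction, which gives \<open>I x \<ge> c |x|\<close> with \<open>c > 0\<close> on every \<open>W\<^sup>j\<close>.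
\<close>

section \<open>Extended logarithms and exponentials\<close>

text \<open>The tiltings \<open>\<beta> j\<close> drive the upper bound. The lower bound takes a new
  tilting for each accuracy, because neither the infimum of the rate over the open set
  \<open>W j\<close> nor the supremum defining the rate need be attained. A point of nearly minimal
  rate is therefore mixed with a little of a point supplied by (C2); at the mixture the relevant
  part of the level set is compact. Near the origin a tube of width proportional to \<open>b\<close>
  is not contained in the cone over \<open>W j\<close>, however small the proportion. There the ball
  in (C3) takes over: no scaled target comes closer to the origin than \<open>\<delta> * b\<close>.
  The exit probability itself is bounded from above through the same pointwise estimate of the
  weight, since its integral is that probability. Both logarithms are thus known to first order as
  real functions of \<open>b\<close>, and efficiency is the quotient of two real limits.\<close>

lemma elog_ennreal: "0 < r \<Longrightarrow> elog (ennreal r) = ereal (ln r)"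
  by (simp add: elog_def)

lemma elog_le_0_iff: "elog x \<le> 0 \<longleftrightarrow> x \<le> 1"
  by (cases x) (auto simp: elog_def top_unique ennreal_le_1)

lemma elog_eq_0_iff: "elog x = 0 \<longleftrightarrow> x = 1"
  by (cases x) (auto simp: elog_def ennreal_eq_1)

lemma elog_less_top_iff: "elog x < \<infinity> \<longleftrightarrow> x < \<infinity>"
  by (cases x) (auto simp: elog_def)

text \<open>Keeping the factor \<open>exp \<bar>y\<bar>\<close> in the Taylor remainder makes the
  bound valid for every \<open>y\<close>; under the integral this factor is paid for by exponential
  moments near \<open>\<theta>\<close>.\<close>

lemma exp_le_quadratic: "exp (y::real) \<le> 1 + y + y\<^sup>2 * exp \<bar>y\<bar>"
proof -
  obtain t where t: "\<bar>t\<bar> \<le> \<bar>y\<bar>" "exp y = (\<Sum>m<2. y ^ m / fact m) + exp t / fact 2 * y\<^sup>2"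
    using Maclaurin_exp_le[of y 2] by auto
  have "exp t / 2 * y\<^sup>2 \<le> exp \<bar>y\<bar> * y\<^sup>2"
    using t(1) order_trans[of "exp t / 2" "exp t" "exp \<bar>y\<bar>"] by (intro mult_right_mono) auto
  then show ?thesis using t(2) by (simp add: numeral_2_eq_2 mult.commute)
qed

text \<open>The largest coordinate controls the norm up to the factor \<open>DIM('a)\<close>, and
  one of its two signs gives the modulus. Exponential moments of the norm thus reduce to finitely
  many values of the moment generating function.\<close>

lemma exp_norm_le_sum:
  fixes x :: "'a::euclidean_space"
  assumes "0 \<le> r"
  shows "exp (r * norm x) \<le>
    (\<Sum>b\<in>Basis. exp (r * DIM('a) * (b \<bullet> x)) + exp (- (r * DIM('a) * (b \<bullet> x))))"
proof -
  obtain b :: 'a where b: "b \<in> Basis" "\<And>c. c \<in> Basis \<Longrightarrow> \<bar>x \<bullet> c\<bar> \<le> \<bar>x \<bullet> b\<bar>"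
    using obtains_MAX[of "Basis :: 'a set" "\<lambda>b. \<bar>x \<bullet> b\<bar>"] 
    by (metis (no_types, lifting) finite_Basis nonempty_Basis Max_ge finite_imageI image_eqI)
  have "norm x \<le> (\<Sum>c\<in>Basis. \<bar>x \<bullet> c\<bar>)" by (rule norm_le_l1)
  also have "\<dots> \<le> of_nat (card (Basis :: 'a set)) * \<bar>x \<bullet> b\<bar>"
    using b(2) by (intro sum_bounded_above) auto
  finally have "r * norm x \<le> r * (DIM('a) * \<bar>b \<bullet> x\<bar>)"
    using assms by (intro mult_left_mono) (auto simp: inner_commute)
  then have "exp (r * norm x) \<le> exp (r * DIM('a) * \<bar>b \<bullet> x\<bar>)" by (simp add: mult.assoc)
  also have "\<dots> \<le> exp (r * DIM('a) * (b \<bullet> x)) + exp (- (r * DIM('a) * (b \<bullet> x)))"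
    by (cases "b \<bullet> x \<ge> 0") (auto simp: abs_if)
  also have "\<dots> \<le> (\<Sum>b\<in>Basis. exp (r * DIM('a) * (b \<bullet> x)) + exp (- (r * DIM('a) * (b \<bullet> x))))"
    using b(1) by (intro member_le_sum) (auto intro: add_nonneg_nonneg)
  finally show ?thesis .
qed

section \<open>Moment generating functions\<close>

text \<open>Without the logarithm the conditions \<Lambda> \<le> 0 and \<Lambda> = 0 become
  comparisons with 1 in \<open>ennreal\<close>, where sums, products and Fatou's lemma apply
  directly.\<close>

definition mgf :: "'w measure \<Rightarrow> ('w \<Rightarrow> 'a::euclidean_space) \<Rightarrow> 'a \<Rightarrow> ennreal" where
  "mgf M Y \<theta> = (\<integral>\<^sup>+\<omega>. ennreal (exp (\<theta> \<bullet> Y \<omega>)) \<partial>M)"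

lemma cgf_le_0_iff: "cgf M Y \<theta> \<le> 0 \<longleftrightarrow> mgf M Y \<theta> \<le> 1"
  and cgf_eq_0_iff: "cgf M Y \<theta> = 0 \<longleftrightarrow> mgf M Y \<theta> = 1"
  and edom_cgf_iff: "\<theta> \<in> edom (cgf M Y) \<longleftrightarrow> mgf M Y \<theta> < \<infinity>"
  by (simp_all add: cgf_def mgf_def elog_le_0_iff elog_eq_0_iff edom_def
      elog_less_top_iff del: ereal_infty_less)

locale light_tailed = prob_space M for M :: "'w measure" +
  fixes Y :: "'w \<Rightarrow> 'a::euclidean_space"
  assumes Y_measurable [measurable]: "Y \<in> borel_measurable M"
    and open_dom: "open (edom (cgf M Y))"
begin

text \<open>The gradient of the moment generating function at \<open>\<theta>\<close>. It is not
  normalised, so it is the drift under the tilting by \<open>\<theta>\<close> on the level set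
  \<open>mgf M Y \<theta> = 1\<close>.\<close>

definition tmean :: "'a \<Rightarrow> 'a" where
  "tmean \<theta> = (\<integral>\<omega>. exp (\<theta> \<bullet> Y \<omega>) *\<^sub>R Y \<omega> \<partial>M)"

lemma integrable_exp_iff: "integrable M (\<lambda>\<omega>. exp (\<theta> \<bullet> Y \<omega>)) \<longleftrightarrow> mgf M Y \<theta> < \<infinity>"
  by (simp add: integrable_iff_bounded mgf_def)

lemma mgf_eq_integral:
  "mgf M Y \<theta> < \<infinity> \<Longrightarrow> mgf M Y \<theta> = ennreal (\<integral>\<omega>. exp (\<theta> \<bullet> Y \<omega>) \<partial>M)"
  unfolding mgf_def by (intro nn_integral_eq_integral) (auto simp: integrable_exp_iff mgf_def)

lemma mgf_0: "mgf M Y 0 = 1"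
  by (simp add: mgf_def emeasure_space_1)

text \<open>A ball around \<open>\<theta>\<close> in the open domain leaves room for an extra
  exponential of the norm, which beats any power of it. One integrable \<open>G\<close> then
  dominates both the derivative and the second order remainder.\<close>

lemma second_order_bound:
  assumes \<theta>: "mgf M Y \<theta> < \<infinity>"
  obtains r G where "0 < r" "integrable M G"
    "\<And>\<omega>. exp (\<theta> \<bullet> Y \<omega>) * norm (Y \<omega>) \<le> G \<omega>"
    "\<And>\<omega>. exp (\<theta> \<bullet> Y \<omega>) * (norm (Y \<omega>))\<^sup>2 * exp (r * norm (Y \<omega>)) \<le> G \<omega>"
proof -
  define d where "d = real DIM('a)"
  have d: "d > 0" by (simp add: d_def)
  obtain e where e: "e > 0" "ball \<theta> e \<subseteq> edom (cgf M Y)"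
    using open_dom \<theta> by (metis edom_cgf_iff open_contains_ball)
  \<comment> \<open>The coordinate bound with exponent \<open>2 * r\<close> moves
    \<open>\<theta>\<close> by \<open>2 * r * d = e / 2\<close> along the axes, hence inside the
    ball of radius \<open>e\<close>. One factor \<open>exp (r * norm (Y \<omega>))\<close> of
    \<open>H\<close> is kept for the remainder, the other absorbs the powers of the norm.\<close>
  define r where "r = e / (4 * d)"
  have r: "r > 0" using e d by (simp add: r_def)
  define H where "H \<omega> = exp (2 * r * norm (Y \<omega>)) * exp (\<theta> \<bullet> Y \<omega>)" for \<omega>
  define H' where "H' \<omega> = (\<Sum>b\<in>Basis. exp ((\<theta> + (2 * r * d) *\<^sub>R b) \<bullet> Y \<omega>) + exp ((\<theta> - (2 * r * d) *\<^sub>R b) \<bullet> Y \<omega>))" for \<omega>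
  have fin: "mgf M Y (\<theta> + (2 * r * d) *\<^sub>R b) < \<infinity>" "mgf M Y (\<theta> - (2 * r * d) *\<^sub>R b) < \<infinity>"
    if "b \<in> Basis" for b :: 'a
  proof -
    have "\<theta> + (2 * r * d) *\<^sub>R b \<in> ball \<theta> e" "\<theta> - (2 * r * d) *\<^sub>R b \<in> ball \<theta> e"
      using that d e by (auto simp: dist_norm r_def)
    then show "mgf M Y (\<theta> + (2 * r * d) *\<^sub>R b) < \<infinity>" "mgf M Y (\<theta> - (2 * r * d) *\<^sub>R b) < \<infinity>"
      using e(2) edom_cgf_iff by blast+
  qed
  have H': "integrable M H'"
    unfolding H'_def
    by (intro Bochner_Integration.integrable_sum Bochner_Integration.integrable_add)
       (auto simp only: integrable_exp_iff fin)
  have "H \<omega> \<le> H' \<omega>" for \<omega>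
  proof -
    have "H \<omega> \<le> (\<Sum>b\<in>Basis. exp (2 * r * d * (b \<bullet> Y \<omega>)) + exp (- (2 * r * d * (b \<bullet> Y \<omega>)))) * exp (\<theta> \<bullet> Y \<omega>)"
      unfolding H_def d_def using r by (intro mult_right_mono exp_norm_le_sum) auto
    also have "\<dots> = H' \<omega>"
      unfolding H'_def by (auto simp: sum_distrib_right distrib_right exp_add[symmetric]
          inner_add_left inner_diff_left add.commute intro!: sum.cong)
    finally show ?thesis .
  qed
  then have "norm (H \<omega>) \<le> norm (H' \<omega>)" for \<omega>
    using abs_ge_self[of "H' \<omega>"] by (auto simp: H_def intro: order_trans)
  moreover have "H \<in> borel_measurable M" unfolding H_def by measurable
  ultimately have H: "integrable M H"
    by (intro Bochner_Integration.integrable_bound[OF H']) auto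
  \<comment> \<open>The two constants come from \<open>r * n \<le> exp (r * n)\<close> and
    \<open>r\<^sup>2 * n\<^sup>2 / 2 \<le> exp (r * n)\<close>.\<close>
  define G where "G \<omega> = (1 / r + 2 / r\<^sup>2) * H \<omega>" for \<omega>
  have bd: "r * n \<le> exp (r * n)" "r\<^sup>2 * n\<^sup>2 / 2 \<le> exp (r * n)" "1 \<le> exp (r * n)" if "n \<ge> 0" for n
  proof -
    show "r * n \<le> exp (r * n)" using exp_ge_add_one_self[of "r * n"] by linarith
    have *: "0 \<le> r * n" using r that by simp
    show "r\<^sup>2 * n\<^sup>2 / 2 \<le> exp (r * n)"
      using exp_lower_Taylor_quadratic[OF *] * by (simp add: power_mult_distrib)
    show "1 \<le> exp (r * n)" using * by simp
  qed
  show thesis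
  proof
    show "0 < r" by fact
    show "integrable M G" unfolding G_def using H by simp
    fix \<omega>
    define n where "n = norm (Y \<omega>)"
    have n: "n \<ge> 0" by (simp add: n_def)
    have HH: "H \<omega> = exp (\<theta> \<bullet> Y \<omega>) * (exp (r * n) * exp (r * n))"
      by (simp add: H_def n_def exp_add[symmetric])
    have H0: "H \<omega> \<ge> 0" by (simp add: H_def)
    have "exp (\<theta> \<bullet> Y \<omega>) * (r * n * 1) \<le> H \<omega>"
      unfolding HH using bd[OF n] n r by (intro mult_left_mono mult_mono) auto
    then have 1: "exp (\<theta> \<bullet> Y \<omega>) * n \<le> (1 / r) * H \<omega>"
      using r by (simp add: field_simps)
    have "exp (\<theta> \<bullet> Y \<omega>) * ((r\<^sup>2 * n\<^sup>2 / 2) * exp (r * n)) \<le> H \<omega>"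
      unfolding HH using bd[OF n] n r by (intro mult_left_mono mult_right_mono) auto
    then have 2: "exp (\<theta> \<bullet> Y \<omega>) * n\<^sup>2 * exp (r * n) \<le> (2 / r\<^sup>2) * H \<omega>"
      using r by (simp add: field_simps)
    have *: "0 \<le> (1 / r) * H \<omega>" "0 \<le> (2 / r\<^sup>2) * H \<omega>" using H0 r by auto
    show "exp (\<theta> \<bullet> Y \<omega>) * norm (Y \<omega>) \<le> G \<omega>"
      using 1 * by (simp add: G_def distrib_right n_def)
    show "exp (\<theta> \<bullet> Y \<omega>) * (norm (Y \<omega>))\<^sup>2 * exp (r * norm (Y \<omega>)) \<le> G \<omega>"
      using 2 * by (simp add: G_def distrib_right n_def)
  qed
qed

lemma integrable_tmean:
  assumes "mgf M Y \<theta> < \<infinity>"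
  shows "integrable M (\<lambda>\<omega>. exp (\<theta> \<bullet> Y \<omega>) *\<^sub>R Y \<omega>)"
proof -
  from second_order_bound[OF assms] obtain G where G: "integrable M G"
    "\<And>\<omega>. exp (\<theta> \<bullet> Y \<omega>) * norm (Y \<omega>) \<le> G \<omega>" by metis
  show ?thesis
    by (rule Bochner_Integration.integrable_bound[OF G(1)])
       (auto intro!: AE_I2 order_trans[OF G(2)])
qed

lemma tmean_0: "tmean 0 = expectation Y"
  by (simp add: tmean_def)

lemma inner_tmean:
  assumes "mgf M Y \<theta> < \<infinity>"
  shows "integrable M (\<lambda>\<omega>. exp (\<theta> \<bullet> Y \<omega>) * (h \<bullet> Y \<omega>))"
    and "(\<integral>\<omega>. exp (\<theta> \<bullet> Y \<omega>) * (h \<bullet> Y \<omega>) \<partial>M) = h \<bullet> tmean \<theta>"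
proof -
  have "integrable M (\<lambda>\<omega>. h \<bullet> (exp (\<theta> \<bullet> Y \<omega>) *\<^sub>R Y \<omega>))"
    using integrable_tmean[OF assms] by (rule integrable_inner_right)
  then show "integrable M (\<lambda>\<omega>. exp (\<theta> \<bullet> Y \<omega>) * (h \<bullet> Y \<omega>))" by simp
  have "h \<bullet> tmean \<theta> = (\<integral>\<omega>. h \<bullet> (exp (\<theta> \<bullet> Y \<omega>) *\<^sub>R Y \<omega>) \<partial>M)"
    unfolding tmean_def
    by (rule integral_inner_right[symmetric]) (rule integrable_tmean[OF assms])
  then show "(\<integral>\<omega>. exp (\<theta> \<bullet> Y \<omega>) * (h \<bullet> Y \<omega>) \<partial>M) = h \<bullet> tmean \<theta>" by simp
qed

text \<open>This one-sided expansion replaces differentiation under the integral. It supplies the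
  descent directions of the Lagrange argument, the linear lower bound of the rate and the Chernoff
  exponents, and it includes finiteness for small \<open>h\<close>.\<close>

lemma mgf_upper_quadratic:
  assumes \<theta>: "mgf M Y \<theta> < \<infinity>"
  obtains r K where "0 < r" "0 \<le> K"
    "\<And>h. norm h \<le> r \<Longrightarrow> mgf M Y (\<theta> + h) \<le> ennreal (enn2real (mgf M Y \<theta>) + h \<bullet> tmean \<theta> + K * (norm h)\<^sup>2)"
proof -
  from second_order_bound[OF \<theta>] obtain r G where r: "0 < r" and G: "integrable M G"
    and le: "\<And>\<omega>. exp (\<theta> \<bullet> Y \<omega>) * (norm (Y \<omega>))\<^sup>2 * exp (r * norm (Y \<omega>)) \<le> G \<omega>" by metis
  have G0: "0 \<le> G \<omega>" for \<omega> by (rule order_trans[OF _ le]) auto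
  have int: "integrable M (\<lambda>\<omega>. exp (\<theta> \<bullet> Y \<omega>))" using \<theta> by (simp add: integrable_exp_iff)
  show thesis
  proof
    show "0 < r" by fact
    show "0 \<le> (\<integral>\<omega>. G \<omega> \<partial>M)" using G0 by simp
    fix h :: 'a assume h: "norm h \<le> r"
    have pt: "exp ((\<theta> + h) \<bullet> Y \<omega>) \<le> exp (\<theta> \<bullet> Y \<omega>) + exp (\<theta> \<bullet> Y \<omega>) * (h \<bullet> Y \<omega>) + (norm h)\<^sup>2 * G \<omega>" for \<omega>
    proof -
      have cs: "\<bar>h \<bullet> Y \<omega>\<bar> \<le> norm h * norm (Y \<omega>)" by (rule Cauchy_Schwarz_ineq2)
      have "(h \<bullet> Y \<omega>)\<^sup>2 \<le> (norm h)\<^sup>2 * (norm (Y \<omega>))\<^sup>2"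
        using power_mono[OF cs, of 2] by (simp add: power_mult_distrib)
      moreover have "exp \<bar>h \<bullet> Y \<omega>\<bar> \<le> exp (r * norm (Y \<omega>))"
        using cs h by (simp add: order_trans[OF cs] mult_right_mono)
      ultimately have "(h \<bullet> Y \<omega>)\<^sup>2 * exp \<bar>h \<bullet> Y \<omega>\<bar> \<le> (norm h)\<^sup>2 * (norm (Y \<omega>))\<^sup>2 * exp (r * norm (Y \<omega>))"
        by (intro mult_mono) auto
      with exp_le_quadratic[of "h \<bullet> Y \<omega>"]
      have "exp (h \<bullet> Y \<omega>) \<le> 1 + h \<bullet> Y \<omega> + (norm h)\<^sup>2 * (norm (Y \<omega>))\<^sup>2 * exp (r * norm (Y \<omega>))" by linarith
      then have "exp (\<theta> \<bullet> Y \<omega>) * exp (h \<bullet> Y \<omega>) \<le> exp (\<theta> \<bullet> Y \<omega>) * (1 + h \<bullet> Y \<omega> + (norm h)\<^sup>2 * (norm (Y \<omega>))\<^sup>2 * exp (r * norm (Y \<omega>)))"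
        by (intro mult_left_mono) auto
      also have "\<dots> = exp (\<theta> \<bullet> Y \<omega>) + exp (\<theta> \<bullet> Y \<omega>) * (h \<bullet> Y \<omega>) + (norm h)\<^sup>2 * (exp (\<theta> \<bullet> Y \<omega>) * (norm (Y \<omega>))\<^sup>2 * exp (r * norm (Y \<omega>)))"
        by (simp add: algebra_simps)
      also have "\<dots> \<le> exp (\<theta> \<bullet> Y \<omega>) + exp (\<theta> \<bullet> Y \<omega>) * (h \<bullet> Y \<omega>) + (norm h)\<^sup>2 * G \<omega>"
        using le[of \<omega>] by (intro add_left_mono mult_left_mono) auto
      finally show ?thesis by (simp add: inner_add_left exp_add)
    qed
    let ?R = "\<lambda>\<omega>. exp (\<theta> \<bullet> Y \<omega>) + exp (\<theta> \<bullet> Y \<omega>) * (h \<bullet> Y \<omega>) + (norm h)\<^sup>2 * G \<omega>"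
    have iR: "integrable M ?R" using int inner_tmean(1)[OF \<theta>] G by simp
    have "mgf M Y (\<theta> + h) \<le> (\<integral>\<^sup>+\<omega>. ennreal (?R \<omega>) \<partial>M)"
      unfolding mgf_def by (intro nn_integral_mono ennreal_leI pt)
    also have "\<dots> = ennreal (\<integral>\<omega>. ?R \<omega> \<partial>M)"
      by (intro nn_integral_eq_integral iR AE_I2 order_trans[OF _ pt]) auto
    also have "(\<integral>\<omega>. ?R \<omega> \<partial>M) = (\<integral>\<omega>. exp (\<theta> \<bullet> Y \<omega>) \<partial>M) + h \<bullet> tmean \<theta> + (norm h)\<^sup>2 * (\<integral>\<omega>. G \<omega> \<partial>M)"
      using int inner_tmean[OF \<theta>, of h] G by simp
    also have "(\<integral>\<omega>. exp (\<theta> \<bullet> Y \<omega>) \<partial>M) = enn2real (mgf M Y \<theta>)"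
      by (subst mgf_eq_integral[OF \<theta>]) simp
    finally show "mgf M Y (\<theta> + h) \<le> ennreal (enn2real (mgf M Y \<theta>) + h \<bullet> tmean \<theta> + (\<integral>\<omega>. G \<omega> \<partial>M) * (norm h)\<^sup>2)"
      by (simp add: mult.commute)
  qed
qed

text \<open>Convexity, obtained by integrating \<open>1 + y \<le> exp y\<close>. It shows that the
  gradient cannot vanish at level 1 once some point lies strictly below that level.\<close>

lemma mgf_ge_tangent:
  assumes \<theta>: "mgf M Y \<theta> < \<infinity>" and \<eta>: "mgf M Y \<eta> < \<infinity>"
  shows "enn2real (mgf M Y \<theta>) + (\<eta> - \<theta>) \<bullet> tmean \<theta> \<le> enn2real (mgf M Y \<eta>)"
proof -
  have "(\<integral>\<omega>. exp (\<theta> \<bullet> Y \<omega>) + exp (\<theta> \<bullet> Y \<omega>) * ((\<eta> - \<theta>) \<bullet> Y \<omega>) \<partial>M) \<le> (\<integral>\<omega>. exp (\<eta> \<bullet> Y \<omega>) \<partial>M)"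
  proof (intro integral_mono)
    fix \<omega>
    have "exp (\<theta> \<bullet> Y \<omega>) * (1 + (\<eta> - \<theta>) \<bullet> Y \<omega>) \<le> exp (\<theta> \<bullet> Y \<omega>) * exp ((\<eta> - \<theta>) \<bullet> Y \<omega>)"
      by (intro mult_left_mono exp_ge_add_one_self) auto
    also have "\<dots> = exp (\<eta> \<bullet> Y \<omega>)" by (simp add: exp_add[symmetric] inner_diff_left)
    finally show "exp (\<theta> \<bullet> Y \<omega>) + exp (\<theta> \<bullet> Y \<omega>) * ((\<eta> - \<theta>) \<bullet> Y \<omega>) \<le> exp (\<eta> \<bullet> Y \<omega>)"
      by (simp add: algebra_simps)
  qed (use assms inner_tmean(1)[OF \<theta>] in \<open>auto simp: integrable_exp_iff\<close>)
  then show ?thesis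
    using inner_tmean[OF \<theta>, of "\<eta> - \<theta>"] \<theta> \<eta>
    by (simp add: integrable_exp_iff mgf_eq_integral)
qed

text \<open>Fatou's lemma gives lower semicontinuity, also at limit points where finiteness of the
  moment is not known beforehand.\<close>

lemma closed_mgf_le_1: "closed {\<theta>. mgf M Y \<theta> \<le> 1}"
  unfolding closed_sequential_limits
proof safe
  fix t l assume t: "\<forall>n. t n \<in> {\<theta>. mgf M Y \<theta> \<le> 1}" "t \<longlonglongrightarrow> l"
  have "mgf M Y l = (\<integral>\<^sup>+\<omega>. liminf (\<lambda>n. ennreal (exp (t n \<bullet> Y \<omega>))) \<partial>M)"
    unfolding mgf_def
    by (intro nn_integral_cong lim_imp_Liminf[symmetric] tendsto_intros t(2)) auto
  also have "\<dots> \<le> liminf (\<lambda>n. mgf M Y (t n))"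
    unfolding mgf_def by (rule nn_integral_liminf) auto
  also have "\<dots> \<le> liminf (\<lambda>n. 1)" using t(1) by (intro Liminf_mono) auto
  finally show "mgf M Y l \<le> 1" by (simp add: Liminf_const)
qed

lemma convex_mgf_le_1: "convex {\<theta>. mgf M Y \<theta> \<le> 1}"
proof (rule convexI, safe)
  fix x y and u v :: real
  assume xy: "mgf M Y x \<le> 1" "mgf M Y y \<le> 1" and uv: "0 \<le> u" "0 \<le> v" "u + v = 1"
  have ce: "convex_on UNIV (exp :: real \<Rightarrow> real)"
    by (rule exp_convex)
  have "mgf M Y (u *\<^sub>R x + v *\<^sub>R y) \<le> (\<integral>\<^sup>+\<omega>. ennreal u * ennreal (exp (x \<bullet> Y \<omega>)) + ennreal v * ennreal (exp (y \<bullet> Y \<omega>)) \<partial>M)"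
    unfolding mgf_def
  proof (intro nn_integral_mono)
    fix \<omega>
    have "exp ((u *\<^sub>R x + v *\<^sub>R y) \<bullet> Y \<omega>) \<le> u * exp (x \<bullet> Y \<omega>) + v * exp (y \<bullet> Y \<omega>)"
      using ce uv unfolding convex_on_def by (simp add: inner_add_left)
    then show "ennreal (exp ((u *\<^sub>R x + v *\<^sub>R y) \<bullet> Y \<omega>)) \<le> ennreal u * ennreal (exp (x \<bullet> Y \<omega>)) + ennreal v * ennreal (exp (y \<bullet> Y \<omega>))"
      using uv by (simp add: ennreal_mult[symmetric] ennreal_plus[symmetric] del: ennreal_plus)
  qed
  also have "\<dots> = ennreal u * mgf M Y x + ennreal v * mgf M Y y"
    by (simp add: nn_integral_add nn_integral_cmult mgf_def)
  also have "\<dots> \<le> ennreal u * 1 + ennreal v * 1"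
    using xy by (intro add_mono mult_left_mono) auto
  also have "\<dots> = 1" using uv by (simp add: ennreal_plus[symmetric] del: ennreal_plus)
  finally show "mgf M Y (u *\<^sub>R x + v *\<^sub>R y) \<le> 1" .
qed

end

section \<open>Duality for the rate function\<close>

lemma pos_cone_ball_0: "0 < \<delta> \<Longrightarrow> pos_cone (ball 0 \<delta>) = (UNIV :: 'a::real_normed_vector set)"
proof (intro set_eqI iffI UNIV_I)
  fix x :: 'a assume "0 < \<delta>"
  define c where "c = (norm x + 1) / \<delta>"
  have c: "c > 0" using \<open>0 < \<delta>\<close> by (simp add: c_def add_nonneg_pos)
  have "norm ((1 / c) *\<^sub>R x) < \<delta>"
    using c \<open>0 < \<delta>\<close> by (simp add: c_def field_simps)
  moreover have "x = c *\<^sub>R ((1 / c) *\<^sub>R x)" using c by simp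
  ultimately show "x \<in> pos_cone (ball 0 \<delta>)"
    unfolding pos_cone_def using c by (metis (mono_tags, lifting) mem_Collect_eq mem_ball_0)
qed

context light_tailed
begin

lemma inner_le_rate: "mgf M Y \<theta> \<le> 1 \<Longrightarrow> ereal (\<theta> \<bullet> x) \<le> rate (cgf M Y) x"
  unfolding rate_def by (intro Sup_upper) (auto simp: cgf_le_0_iff)

text \<open>The directions \<open>u\<close> along which the set \<open>\<Lambda> \<le> 0\<close> is unbounded make an obtuse angle with \<open>x\<close>;
  this is what makes the supremum defining the rate of \<open>x\<close> attained.\<close>

definition barrier :: "'a \<Rightarrow> bool" where
  "barrier x \<longleftrightarrow> (\<forall>u. u \<noteq> 0 \<longrightarrow> (\<forall>s\<ge>0. mgf M Y (s *\<^sub>R u) \<le> 1) \<longrightarrow> u \<bullet> x < 0)"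

text \<open>Along such a ray \<Lambda> \<le> 0, so \<open>s * (u \<bullet> v)\<close> is bounded by
  the Legendre transform at \<open>v\<close> for all \<open>s \<ge> 0\<close>; this forces
  \<open>u \<bullet> v \<le> 0\<close> on its domain and hence on the cone. At an interior point a
  small move along \<open>u\<close> stays in the cone and makes the inequality strict.\<close>

lemma barrier_interior_dom:
  assumes y: "y \<in> interior (pos_cone (edom (legendre (cgf M Y))))"
  shows "barrier y"
  unfolding barrier_def
proof safe
  fix u :: 'a assume u: "u \<noteq> 0" "\<forall>s\<ge>0. mgf M Y (s *\<^sub>R u) \<le> 1"
  obtain e where e: "e > 0" "ball y e \<subseteq> pos_cone (edom (legendre (cgf M Y)))"
    using y by (metis mem_interior)
  define f where "f = e / (2 * norm u)"
  have f: "f > 0" using e u by (simp add: f_def)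
  have "y + f *\<^sub>R u \<in> ball y e" using e u by (simp add: dist_norm f_def)
  with e obtain c v where c: "c > 0" "y + f *\<^sub>R u = c *\<^sub>R v" "v \<in> edom (legendre (cgf M Y))"
    unfolding pos_cone_def by blast
  have bound: "ereal (s * (u \<bullet> v)) \<le> legendre (cgf M Y) v" if "s \<ge> 0" for s
  proof -
    have "cgf M Y (s *\<^sub>R u) \<le> 0" using u that by (simp add: cgf_le_0_iff)
    then have "ereal (s * (u \<bullet> v)) - 0 \<le> ereal ((s *\<^sub>R u) \<bullet> v) - cgf M Y (s *\<^sub>R u)"
      by (intro ereal_minus_mono) auto
    also have "\<dots> \<le> legendre (cgf M Y) v" unfolding legendre_def by (rule SUP_upper) simp
    finally show ?thesis by simp
  qed
  have "u \<bullet> v \<le> 0"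
  proof (rule ccontr)
    assume *: "\<not> u \<bullet> v \<le> 0"
    from c(3) bound[of 0] obtain B where B: "legendre (cgf M Y) v = ereal B"
      unfolding edom_def by (cases "legendre (cgf M Y) v") auto
    have "B \<ge> 0" using bound[of 0] B by simp
    then show False using bound[of "(B + 1) / (u \<bullet> v)"] B * by simp
  qed
  then have "u \<bullet> (y + f *\<^sub>R u) \<le> 0" unfolding c(2) using c(1) by (simp add: mult_nonneg_nonpos)
  moreover have "f * (u \<bullet> u) > 0" using f u by simp
  ultimately show "u \<bullet> y < 0" by (simp add: inner_add_right)
qed

text \<open>Finiteness of the rate at \<open>x\<close> gives only the weak inequality
  \<open>u \<bullet> x \<le> 0\<close>; any positive weight on \<open>y\<close> restores
  strictness.\<close>

lemma barrier_convex_comb: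
  assumes "rate (cgf M Y) x < \<infinity>" "barrier y" "0 < s" "s \<le> 1"
  shows "barrier ((1 - s) *\<^sub>R x + s *\<^sub>R y)"
  unfolding barrier_def
proof safe
  fix u :: 'a assume u: "u \<noteq> 0" "\<forall>s\<ge>0. mgf M Y (s *\<^sub>R u) \<le> 1"
  then have "u \<bullet> y < 0" using assms(2) by (auto simp: barrier_def)
  moreover have "u \<bullet> x \<le> 0"
  proof (rule ccontr)
    assume *: "\<not> u \<bullet> x \<le> 0"
    have bound: "ereal (t * (u \<bullet> x)) \<le> rate (cgf M Y) x" if "t \<ge> 0" for t
      using inner_le_rate[of "t *\<^sub>R u" x] u that by simp
    from assms(1) bound[of 0] obtain B where B: "rate (cgf M Y) x = ereal B"
      by (cases "rate (cgf M Y) x") auto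
    have "B \<ge> 0" using bound[of 0] B by simp
    then show False using bound[of "(B + 1) / (u \<bullet> x)"] B * by simp
  qed
  ultimately have "(1 - s) * (u \<bullet> x) + s * (u \<bullet> y) < 0"
    using assms(3,4) by (intro add_nonpos_neg) (auto intro: mult_nonneg_nonpos mult_pos_neg)
  then show "u \<bullet> ((1 - s) *\<^sub>R x + s *\<^sub>R y) < 0" by (simp add: inner_add_right)
qed

text \<open>An unbounded closed convex set containing 0 contains a whole ray from 0. Here the
  direction of that ray would have nonnegative product with \<open>x\<close>, which
  \<open>barrier\<close> excludes.\<close>

lemma compact_section:
  assumes "barrier x"
  shows "compact {\<theta>. mgf M Y \<theta> \<le> 1 \<and> 0 \<le> \<theta> \<bullet> x}"
proof -
  let ?K = "{\<theta>. mgf M Y \<theta> \<le> 1 \<and> 0 \<le> \<theta> \<bullet> x}"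
  have K: "?K = {\<theta>. mgf M Y \<theta> \<le> 1} \<inter> {\<theta>. 0 \<le> x \<bullet> \<theta>}" by (auto simp: inner_commute)
  have cl: "closed ?K"
    unfolding K by (intro closed_Int closed_mgf_le_1 closed_halfspace_ge)
  have cv: "convex ?K"
    unfolding K by (intro convex_Int convex_mgf_le_1 convex_halfspace_ge)
  have "bounded ?K"
  proof (rule ccontr)
    assume "\<not> bounded ?K"
    then have "\<forall>n::nat. \<exists>t\<in>?K. real n + 1 < norm t"
      unfolding bounded_iff by (meson not_le)
    then obtain t where t: "\<And>n. t n \<in> ?K" "\<And>n. real n + 1 < norm (t n)" by metis
    have nz: "norm (t n) > 0" for n using t(2)[of n] by linarith
    define u where "u n = t n /\<^sub>R norm (t n)" for n
    have un: "u n \<in> sphere 0 1" for n using nz[of n] by (simp add: u_def)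
    obtain l \<sigma> where l: "l \<in> sphere 0 1" "strict_mono \<sigma>" "(u \<circ> \<sigma>) \<longlonglongrightarrow> l"
      using compact_sphere[of "0::'a" 1] un unfolding compact_def by (metis (no_types, lifting))
    \<comment> \<open>Once \<open>norm (t n)\<close> exceeds \<open>s\<close>, the point at distance
      \<open>s\<close> in direction \<open>u n\<close> lies on the segment from 0 to
      \<open>t n\<close>, hence in the convex set; closedness keeps the limit in it.\<close>
    have ray: "s *\<^sub>R l \<in> ?K" if s: "s \<ge> 0" for s
    proof (rule Lim_in_closed_set[OF cl])
      show "(\<lambda>n. s *\<^sub>R (u \<circ> \<sigma>) n) \<longlonglongrightarrow> s *\<^sub>R l" by (intro tendsto_intros l(3))
      have "eventually (\<lambda>n. real n \<ge> s) sequentially"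
        using eventually_ge_at_top[of "nat \<lceil>s\<rceil>"] by eventually_elim linarith
      then show "eventually (\<lambda>n. s *\<^sub>R (u \<circ> \<sigma>) n \<in> ?K) sequentially"
      proof eventually_elim
        case (elim n)
        let ?m = "\<sigma> n"
        have "s \<le> norm (t ?m)"
          using elim seq_suble[OF l(2), of n] t(2)[of ?m] by linarith
        then have "0 \<le> s / norm (t ?m)" "s / norm (t ?m) \<le> 1" using s nz[of ?m] by auto
        moreover have "0 \<in> ?K" by (simp add: mgf_0)
        ultimately have "(1 - s / norm (t ?m)) *\<^sub>R 0 + (s / norm (t ?m)) *\<^sub>R t ?m \<in> ?K"
          using cv t(1)[of ?m] unfolding convex_alt by blast
        then show ?case by (simp add: u_def divide_inverse)
      qed
    qed simp
    then have "\<forall>s\<ge>0. mgf M Y (s *\<^sub>R l) \<le> 1" "0 \<le> l \<bullet> x"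
      using ray[of 1] by auto
    moreover have "l \<noteq> 0" using l(1) by auto
    ultimately show False using assms unfolding barrier_def by (meson not_le)
  qed
  with cl show ?thesis by (simp add: compact_eq_bounded_closed)
qed

text \<open>Since 0 lies in the section, points with negative product cannot compete, and the
  supremum over the level set is a maximum over a compact set.\<close>

lemma rate_attained:
  assumes "barrier x"
  obtains \<theta> where "mgf M Y \<theta> \<le> 1" "0 \<le> \<theta> \<bullet> x" "\<And>\<eta>. mgf M Y \<eta> \<le> 1 \<Longrightarrow> \<eta> \<bullet> x \<le> \<theta> \<bullet> x"
proof -
  let ?K = "{\<theta>. mgf M Y \<theta> \<le> 1 \<and> 0 \<le> \<theta> \<bullet> x}"
  have "0 \<in> ?K" by (simp add: mgf_0)
  then have "?K \<noteq> {}" by blast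
  moreover have "continuous_on ?K (\<lambda>\<eta>. \<eta> \<bullet> x)" by (intro continuous_intros)
  ultimately obtain \<theta> where \<theta>: "\<theta> \<in> ?K" "\<And>\<eta>. \<eta> \<in> ?K \<Longrightarrow> \<eta> \<bullet> x \<le> \<theta> \<bullet> x"
    using continuous_attains_sup[OF compact_section[OF assms], of "\<lambda>\<eta>. \<eta> \<bullet> x"] by blast
  show thesis
  proof (rule that)
    fix \<eta> assume "mgf M Y \<eta> \<le> 1"
    then show "\<eta> \<bullet> x \<le> \<theta> \<bullet> x"
      using \<theta> by (cases "0 \<le> \<eta> \<bullet> x") auto
  qed (use \<theta> in auto)
qed

text \<open>These are the feasible directions of the Lagrange argument. Strictly below the level
  every direction is admissible by continuity; on the level a negative derivative is required, and
  for small steps it beats the quadratic remainder.\<close>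

lemma mgf_descent:
  assumes "mgf M Y \<theta> < \<infinity>" and h: "enn2real (mgf M Y \<theta>) < c \<or> enn2real (mgf M Y \<theta>) = c \<and> h \<bullet> tmean \<theta> < 0"
  shows "\<exists>s>0. mgf M Y (\<theta> + s *\<^sub>R h) < ennreal c"
proof -
  let ?m = "enn2real (mgf M Y \<theta>)"
  obtain r K where r: "0 < r" and K: "0 \<le> K" and le:
    "\<And>h. norm h \<le> r \<Longrightarrow> mgf M Y (\<theta> + h) \<le> ennreal (?m + h \<bullet> tmean \<theta> + K * (norm h)\<^sup>2)"
    using mgf_upper_quadratic[OF assms(1)] by metis
  define g where "g s = ?m + s * (h \<bullet> tmean \<theta>) + K * (s * norm h)\<^sup>2" for s :: real
  have "\<exists>s>0. s * norm h \<le> r \<and> g s < c"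
  proof -
    have ev: "eventually (\<lambda>s. s * norm h < r) (at_right 0)"
      by (rule order_tendstoD(2)[of _ 0]) (use r in \<open>auto intro!: tendsto_eq_intros\<close>)
    have "eventually (\<lambda>s. g s < c) (at_right 0)"
    proof (cases "?m < c")
      case True
      show ?thesis unfolding g_def
        by (rule order_tendstoD(2)[of _ ?m]) (use True in \<open>auto intro!: tendsto_eq_intros\<close>)
    next
      case False
      with h have 1: "?m = c" "h \<bullet> tmean \<theta> < 0" by auto
      have "eventually (\<lambda>s. h \<bullet> tmean \<theta> + K * s * (norm h)\<^sup>2 < 0) (at_right 0)"
        by (rule order_tendstoD(2)[of _ "h \<bullet> tmean \<theta>"]) (use 1 in \<open>auto intro!: tendsto_eq_intros\<close>)
      moreover have "eventually (\<lambda>s::real. s > 0) (at_right 0)" by (rule eventually_at_right_less)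
      ultimately show ?thesis
      proof eventually_elim
        case (elim s)
        then have "s * (h \<bullet> tmean \<theta> + K * s * (norm h)\<^sup>2) < 0" by (simp add: mult_pos_neg)
        then show ?case by (simp add: g_def 1 algebra_simps power2_eq_square)
      qed
    qed
    with ev eventually_at_right_less[of 0]
    have "eventually (\<lambda>s. 0 < s \<and> s * norm h \<le> r \<and> g s < c) (at_right 0)"
      by eventually_elim auto
    then show ?thesis using eventually_happens[of _ "at_right (0::real)"] by auto
  qed
  then obtain s where s: "s > 0" "s * norm h \<le> r" "g s < c" by blast
  \<comment> \<open>\<open>ennreal\<close> sends negative reals to 0, so the strict inequality
    carries over only for positive \<open>c\<close>; positivity comes from that of the
    integral.\<close>
  have c: "c > 0"
  proof -
    have "mgf M Y \<theta> \<noteq> 0"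
    proof
      assume "mgf M Y \<theta> = 0"
      then have "AE \<omega> in M. ennreal (exp (\<theta> \<bullet> Y \<omega>)) = 0"
        unfolding mgf_def by (subst (asm) nn_integral_0_iff_AE) auto
      then show False by simp
    qed
    then have "?m > 0" using assms(1) by (simp add: enn2real_positive_iff zero_less_iff_neq_zero)
    then show ?thesis using h by auto
  qed
  have "mgf M Y (\<theta> + s *\<^sub>R h) \<le> ennreal (g s)"
    using le[of "s *\<^sub>R h"] s by (simp add: g_def)
  also have "\<dots> < ennreal c" using s c by (auto simp: ennreal_less_iff ennreal_lessI)
  finally show ?thesis using s by blast
qed

lemma mgf_less_1_exists:
  assumes "tmean 0 \<noteq> 0"
  shows "\<exists>\<theta>. mgf M Y \<theta> < 1"
  using mgf_descent[of 0 1 "- tmean 0"] assms by (auto simp: mgf_0)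

text \<open>A Farkas lemma with one constraint. If the component \<open>p\<close> of
  \<open>x\<close> orthogonal to \<open>m\<close> were nonzero, \<open>p\<close> tilted slightly
  against \<open>m\<close> would lie in the open half-space and still have positive product with
  \<open>x\<close>. Testing with \<open>- m\<close> then fixes the sign of the multiplier.\<close>

lemma aligned_of_halfspace:
  fixes x m :: 'a
  assumes "m \<noteq> 0" "x \<noteq> 0" and H: "\<And>h. h \<bullet> m < 0 \<Longrightarrow> h \<bullet> x \<le> 0"
  obtains l where "0 < l" "x = l *\<^sub>R m"
proof -
  have mm: "m \<bullet> m > 0" using assms by simp
  define l where "l = (x \<bullet> m) / (m \<bullet> m)"
  define p where "p = x - l *\<^sub>R m"
  have pm: "p \<bullet> m = 0" using mm by (simp add: p_def l_def inner_diff_left)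
  have "p \<bullet> p \<le> 0"
  proof (rule ccontr)
    assume *: "\<not> p \<bullet> p \<le> 0"
    have "x = p + l *\<^sub>R m" by (simp add: p_def)
    then have px: "p \<bullet> x = p \<bullet> p" using pm by (simp add: inner_add_right)
    \<comment> \<open>Small enough that \<open>s * (m \<bullet> x)\<close> is at most half of
      \<open>p \<bullet> p\<close>; the summand 1 avoids a zero denominator.\<close>
    define s where "s = p \<bullet> p / (2 * (\<bar>m \<bullet> x\<bar> + 1))"
    have s: "s > 0" using * unfolding s_def by (intro divide_pos_pos) (auto simp: add_nonneg_pos)
    have "(p - s *\<^sub>R m) \<bullet> m < 0" using pm s mm by (simp add: inner_diff_left)
    then have "p \<bullet> p \<le> s * (m \<bullet> x)" using H[of "p - s *\<^sub>R m"] px by (simp add: inner_diff_left)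
    also have "\<dots> \<le> s * (\<bar>m \<bullet> x\<bar> + 1)" using s by (intro mult_left_mono) auto
    also have "\<dots> = p \<bullet> p / 2"
    proof -
      have "A \<noteq> 0 \<Longrightarrow> p \<bullet> p / (2 * A) * A = p \<bullet> p / 2" for A :: real by simp
      then show ?thesis unfolding s_def by (smt (verit) abs_ge_zero)
    qed
    finally show False using * by simp
  qed
  then have "p = 0" by (metis inner_gt_zero_iff not_le)
  then have x: "x = l *\<^sub>R m" by (simp add: p_def)
  have "(- m) \<bullet> x \<le> 0" using mm by (intro H) simp
  then have "l * (m \<bullet> m) \<ge> 0" by (subst (asm) x) simp
  then have "l \<ge> 0" using mm by (simp add: zero_le_mult_iff)
  moreover have "l \<noteq> 0" using x assms by auto
  ultimately show thesis using x that[of l] by simp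
qed

text \<open>The gradient of the moment generating function is normal to its level set at a
  maximiser of a linear functional (Lagrange).\<close>

lemma rate_maximiser:
  assumes "barrier x" "x \<noteq> 0" "tmean 0 \<noteq> 0"
  obtains \<theta> l where "mgf M Y \<theta> = 1" "0 < l" "x = l *\<^sub>R tmean \<theta>"
proof -
  obtain \<theta> where \<theta>: "mgf M Y \<theta> \<le> 1" and max: "\<And>\<eta>. mgf M Y \<eta> \<le> 1 \<Longrightarrow> \<eta> \<bullet> x \<le> \<theta> \<bullet> x"
    using rate_attained[OF assms(1)] by metis
  have fin: "mgf M Y \<theta> < \<infinity>" using \<theta> by (auto simp: less_top[symmetric] top_unique)
  have le: "enn2real (mgf M Y \<theta>) \<le> 1" using enn2real_mono[OF \<theta>] by simp
  have desc: "h \<bullet> x \<le> 0" if h: "enn2real (mgf M Y \<theta>) < 1 \<or> enn2real (mgf M Y \<theta>) = 1 \<and> h \<bullet> tmean \<theta> < 0" for h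
  proof -
    obtain s where s: "s > 0" "mgf M Y (\<theta> + s *\<^sub>R h) < 1"
      using mgf_descent[OF fin h] by auto
    then have "(\<theta> + s *\<^sub>R h) \<bullet> x \<le> \<theta> \<bullet> x" by (intro max) auto
    then show ?thesis using s by (simp add: inner_add_left mult_le_0_iff)
  qed
  \<comment> \<open>If the constraint were slack, the direction \<open>x\<close> itself would be
    admissible, against \<open>x \<bullet> x > 0\<close>.\<close>
  have eq: "enn2real (mgf M Y \<theta>) = 1"
    using desc[of x] assms(2) le inner_gt_zero_iff[of x] by force
  have 1: "mgf M Y \<theta> = 1"
    using eq fin by (cases "mgf M Y \<theta>") auto
  \<comment> \<open>A Slater point: by the tangent inequality a zero gradient at level 1 would make
    1 the minimum.\<close>
  obtain \<eta> where \<eta>: "mgf M Y \<eta> < 1" using mgf_less_1_exists[OF assms(3)] by blast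
  then have \<eta>fin: "mgf M Y \<eta> < \<infinity>" by (rule less_trans) simp
  have "enn2real (mgf M Y \<eta>) < 1"
    using \<eta> by (cases "mgf M Y \<eta>") (auto simp: ennreal_less_one_iff)
  then have "tmean \<theta> \<noteq> 0" using mgf_ge_tangent[OF fin \<eta>fin] eq by auto
  then obtain l where "0 < l" "x = l *\<^sub>R tmean \<theta>"
    using aligned_of_halfspace[of "tmean \<theta>" x] assms(2) desc eq by blast
  then show thesis using 1 that by blast
qed

text \<open>A point \<open>x\<close> of nearly minimal rate need not satisfy \<open>barrier\<close>,
  so it is moved slightly towards a point \<open>y\<close> that does. The cost stays below
  \<open>c\<close> by linearity: the maximiser \<open>\<theta>\<close> at the mixture pairs with
  \<open>x\<close> to at most the rate of \<open>x\<close>, and with \<open>y\<close> to at most the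
  maximum at \<open>y\<close>.\<close>

lemma near_optimal_tilt:
  assumes W: "convex W" "0 \<notin> W" and int: "interior (pos_cone (edom (legendre (cgf M Y)))) \<inter> W \<noteq> {}"
    and "tmean 0 \<noteq> 0" and c: "set_rate (cgf M Y) W < ereal c"
  obtains \<theta> l where "mgf M Y \<theta> = 1" "0 < l" "l *\<^sub>R tmean \<theta> \<in> W" "l * (\<theta> \<bullet> tmean \<theta>) < c"
proof -
  obtain x where x: "x \<in> W" "rate (cgf M Y) x < ereal c"
    using c unfolding set_rate_def by (auto simp: INF_less_iff)
  obtain y where y: "y \<in> W" "barrier y" using int barrier_interior_dom by blast
  have nn: "0 \<le> rate (cgf M Y) z" for z using inner_le_rate[of 0 z] by (simp add: mgf_0 zero_ereal_def)
  obtain a where a: "rate (cgf M Y) x = ereal a" using x nn[of x] by (cases "rate (cgf M Y) x") auto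
  have "a < c" using a x by simp
  obtain t where t: "\<And>\<eta>. mgf M Y \<eta> \<le> 1 \<Longrightarrow> \<eta> \<bullet> y \<le> t \<bullet> y" using rate_attained[OF y(2)] by metis
  have ev: "eventually (\<lambda>s. (1 - s) * a + s * (t \<bullet> y) < c) (at_right 0)"
    by (rule order_tendstoD(2)[of _ a]) (use \<open>a < c\<close> in \<open>auto intro!: tendsto_eq_intros\<close>)
  have "eventually (\<lambda>s::real. s < 1) (at_right 0)"
    by (rule order_tendstoD(2)[of _ 0]) auto
  with ev eventually_at_right_less[of 0]
  have "eventually (\<lambda>s. 0 < s \<and> s < 1 \<and> (1 - s) * a + s * (t \<bullet> y) < c) (at_right 0)"
    by eventually_elim auto
  then obtain s where s: "0 < s" "s < 1" "(1 - s) * a + s * (t \<bullet> y) < c"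
    using eventually_happens[of _ "at_right (0::real)"] by auto
  define z where "z = (1 - s) *\<^sub>R x + s *\<^sub>R y"
  have zW: "z \<in> W" using W(1) x(1) y(1) s unfolding z_def convex_alt by auto
  have bz: "barrier z" unfolding z_def using s a y by (intro barrier_convex_comb) auto
  have "z \<noteq> 0" using zW W by auto
  then obtain \<theta> l where \<theta>: "mgf M Y \<theta> = 1" "0 < l" "z = l *\<^sub>R tmean \<theta>"
    using rate_maximiser[OF bz _ assms(4)] by metis
  have "\<theta> \<bullet> x \<le> a" "\<theta> \<bullet> y \<le> t \<bullet> y"
    using inner_le_rate[of \<theta> x] a \<theta>(1) t[of \<theta>] by auto
  then have "(1 - s) * (\<theta> \<bullet> x) + s * (\<theta> \<bullet> y) \<le> (1 - s) * a + s * (t \<bullet> y)"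
    using s by (intro add_mono mult_left_mono) auto
  then have "\<theta> \<bullet> z < c" using s(3) by (simp add: z_def inner_add_right)
  then show thesis using \<theta> zW by (intro that[of \<theta> l]) auto
qed

text \<open>With zero mean the cone over the ball would be the whole space and \<open>W\<close>
  would be empty.\<close>

lemma expectation_nonzero:
  assumes "0 < \<delta>" "pos_cone (ball (expectation Y) \<delta>) \<inter> W = {}" "W \<noteq> {}"
  shows "tmean 0 \<noteq> 0"
  using assms pos_cone_ball_0[of \<delta>, where ?'a = 'a] by (auto simp: tmean_0)

text \<open>If \<open>t *\<^sub>R u\<close> is the point of the ray through \<open>x\<close> nearest to the mean \<open>\<mu>\<close>, then moving from
  \<open>0\<close> in the direction \<open>t *\<^sub>R u - \<mu>\<close>, tilted slightly towards \<open>u\<close>, decreases the cumulant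
  generating function, at a rate depending only on \<open>\<delta>\<close>.\<close>

lemma rate_ge_linear:
  assumes \<delta>: "0 < \<delta>"
  obtains c where "0 < c"
    "\<And>x. x \<notin> pos_cone (ball (expectation Y) \<delta>) \<Longrightarrow> ereal (c * norm x) \<le> rate (cgf M Y) x"
proof -
  define \<mu> where "\<mu> = expectation Y"
  obtain r K where r: "0 < r" and K: "0 \<le> K" and le:
    "\<And>h. norm h \<le> r \<Longrightarrow> mgf M Y (0 + h) \<le> ennreal (enn2real (mgf M Y 0) + h \<bullet> tmean 0 + K * (norm h)\<^sup>2)"
    using mgf_upper_quadratic[of 0] by (auto simp: mgf_0)
  \<comment> \<open>The tilt towards \<open>u\<close> may spend half of the linear gain
    \<open>\<delta>\<^sup>2\<close>, so \<open>\<eta> * norm \<mu>\<close> must not exceed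
    \<open>\<delta>\<^sup>2 / 2\<close>.\<close>
  define \<eta> where "\<eta> = \<delta>\<^sup>2 / (2 * (norm \<mu> + 1))"
  have \<eta>: "\<eta> > 0" using \<delta> by (simp add: \<eta>_def add_nonneg_pos)
  have \<eta>\<mu>: "\<eta> * norm \<mu> \<le> \<delta>\<^sup>2 / 2"
  proof -
    have "\<eta> * norm \<mu> \<le> \<eta> * (norm \<mu> + 1)" using \<eta> by (intro mult_left_mono) auto
    also have "\<dots> = \<delta>\<^sup>2 / 2" using norm_ge_zero[of \<mu>] unfolding \<eta>_def by (simp add: field_simps add_nonneg_eq_0_iff)
    finally show ?thesis .
  qed
  \<comment> \<open>\<open>B\<close> bounds the norm of the direction \<open>v\<close> below. In
    \<open>\<epsilon>\<close>, the first term of the minimum keeps the step within the range of the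
    expansion, and the second lets the other half of the linear gain absorb the quadratic
    term.\<close>
  define B where "B = 2 * norm \<mu> + \<eta>"
  have B: "B > 0" using \<eta> by (simp add: B_def add_nonneg_pos)
  define \<epsilon> where "\<epsilon> = min (r / B) (\<delta>\<^sup>2 / 2 / ((K + 1) * B\<^sup>2))"
  have \<epsilon>: "\<epsilon> > 0" using r B \<delta> K by (simp add: \<epsilon>_def)
  have \<epsilon>B: "\<epsilon> * B \<le> r" "\<epsilon> * ((K + 1) * B\<^sup>2) \<le> \<delta>\<^sup>2 / 2"
  proof -
    have "\<epsilon> \<le> r / B" "\<epsilon> \<le> \<delta>\<^sup>2 / 2 / ((K + 1) * B\<^sup>2)" by (simp_all add: \<epsilon>_def)
    moreover have "(K + 1) * B\<^sup>2 > 0" using K B by simp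
    ultimately show "\<epsilon> * B \<le> r" "\<epsilon> * ((K + 1) * B\<^sup>2) \<le> \<delta>\<^sup>2 / 2"
      using B by (simp_all only: pos_le_divide_eq)
  qed
  show thesis
  proof (rule that)
    show "0 < \<epsilon> * \<eta>" using \<epsilon> \<eta> by simp
    fix x assume x: "x \<notin> pos_cone (ball (expectation Y) \<delta>)"
    show "ereal (\<epsilon> * \<eta> * norm x) \<le> rate (cgf M Y) x"
    proof (cases "x = 0")
      case True then show ?thesis using inner_le_rate[of 0 x] by (simp add: mgf_0)
    next
      case False
      define u where "u = x /\<^sub>R norm x"
      have uu: "u \<bullet> u = 1" "norm u = 1" using False by (simp_all add: u_def dot_square_norm power2_eq_square)
      have xu: "x = norm x *\<^sub>R u" using False by (simp add: u_def)
      have far: "norm (\<mu> - t *\<^sub>R u) \<ge> \<delta>" if t: "t > 0" for t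
      proof (rule ccontr)
        assume "\<not> norm (\<mu> - t *\<^sub>R u) \<ge> \<delta>"
        then have "t *\<^sub>R u \<in> ball (expectation Y) \<delta>" by (simp add: \<mu>_def dist_norm)
        moreover have "x = (norm x / t) *\<^sub>R (t *\<^sub>R u)" using t xu by simp
        moreover have "norm x / t > 0" using t False by simp
        ultimately show False using x unfolding pos_cone_def by blast
      qed
      \<comment> \<open>The cone is built with positive scalars, so the endpoint 0 of the ray is
        reached as a limit.\<close>
      have far0: "norm \<mu> \<ge> \<delta>"
      proof (rule tendsto_lowerbound)
        show "((\<lambda>t. norm (\<mu> - t *\<^sub>R u)) \<longlongrightarrow> norm \<mu>) (at_right 0)"
          by (auto intro!: tendsto_eq_intros)
        show "eventually (\<lambda>t. \<delta> \<le> norm (\<mu> - t *\<^sub>R u)) (at_right 0)"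
          using eventually_at_right_less[of 0] by eventually_elim (rule far)
      qed simp
      \<comment> \<open>The projection of \<open>\<mu>\<close> onto the closed ray. Both cases of
        the maximum satisfy \<open>t * (u \<bullet> \<mu>) = t * t\<close>, which is what the
        computation of the distance uses.\<close>
      define t where "t = max 0 (u \<bullet> \<mu>)"
      have far_t: "norm (\<mu> - t *\<^sub>R u) \<ge> \<delta>" using far[of t] far0 by (cases "t > 0") (auto simp: t_def)
      have t\<mu>: "t * (u \<bullet> \<mu>) = t * t" by (auto simp: t_def max_def)
      have "(norm (\<mu> - t *\<^sub>R u))\<^sup>2 = \<mu> \<bullet> \<mu> - 2 * (t * (u \<bullet> \<mu>)) + t * t"
        unfolding power2_norm_eq_inner using uu by (simp add: inner_diff_left inner_diff_right inner_commute algebra_simps)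
      then have sq: "\<delta>\<^sup>2 \<le> \<mu> \<bullet> \<mu> - t * (u \<bullet> \<mu>)"
        using power_mono[OF far_t, of 2] \<delta> t\<mu> by linarith
      define v where "v = t *\<^sub>R u - \<mu> + \<eta> *\<^sub>R u"
      have u\<mu>: "\<bar>u \<bullet> \<mu>\<bar> \<le> norm \<mu>" using Cauchy_Schwarz_ineq2[of u \<mu>] uu by simp
      have "norm v \<le> norm (t *\<^sub>R u - \<mu>) + norm (\<eta> *\<^sub>R u)" unfolding v_def by (rule norm_triangle_ineq)
      also have "\<dots> \<le> t + norm \<mu> + \<eta>" using norm_triangle_ineq4[of "t *\<^sub>R u" \<mu>] uu \<eta> by (simp add: t_def)
      also have "\<dots> \<le> B" using u\<mu> by (simp add: t_def B_def)
      finally have vB: "norm v \<le> B" .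
      have "\<eta> * (u \<bullet> \<mu>) \<le> \<eta> * norm \<mu>" using \<eta> u\<mu> by (intro mult_left_mono) auto
      then have v\<mu>: "v \<bullet> \<mu> \<le> - \<delta>\<^sup>2 / 2"
        using sq \<eta>\<mu> by (simp add: v_def inner_add_left inner_diff_left)
      have vu: "v \<bullet> u \<ge> \<eta>" using uu by (simp add: v_def inner_add_left inner_diff_left t_def inner_commute[of \<mu>])
      have nle: "norm (\<epsilon> *\<^sub>R v) \<le> r"
        using \<epsilon> order_trans[OF mult_left_mono[OF vB, of \<epsilon>] \<epsilon>B(1)] by simp
      have "K * (norm (\<epsilon> *\<^sub>R v))\<^sup>2 \<le> (K + 1) * (\<epsilon> * B)\<^sup>2"
        using K vB \<epsilon> by (intro mult_mono power_mono) auto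
      also have "\<dots> = \<epsilon> * (\<epsilon> * ((K + 1) * B\<^sup>2))" by (simp add: power2_eq_square algebra_simps)
      also have "\<dots> \<le> \<epsilon> * (\<delta>\<^sup>2 / 2)" using \<epsilon> \<epsilon>B by (intro mult_left_mono) auto
      finally have "1 + (\<epsilon> *\<^sub>R v) \<bullet> \<mu> + K * (norm (\<epsilon> *\<^sub>R v))\<^sup>2 \<le> 1 + \<epsilon> * (v \<bullet> \<mu> + \<delta>\<^sup>2 / 2)"
        by (simp add: algebra_simps)
      also have "\<dots> \<le> 1" using \<epsilon> v\<mu> by (simp add: mult_nonneg_nonpos)
      finally have "mgf M Y (\<epsilon> *\<^sub>R v) \<le> 1"
        using le[OF nle] by (auto simp: mgf_0 tmean_0 \<mu>_def[symmetric] intro: order_trans ennreal_leI)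
      then have "ereal ((\<epsilon> *\<^sub>R v) \<bullet> x) \<le> rate (cgf M Y) x" by (rule inner_le_rate)
      moreover have "\<epsilon> * \<eta> * norm x \<le> (\<epsilon> *\<^sub>R v) \<bullet> x"
      proof -
        have "\<epsilon> * norm x * \<eta> \<le> \<epsilon> * norm x * (v \<bullet> u)" using \<epsilon> vu by (intro mult_left_mono) auto
        also have "\<dots> = (\<epsilon> *\<^sub>R v) \<bullet> x" by (simp add: u_def False)
        finally show ?thesis by (simp add: mult_ac)
      qed
      ultimately show ?thesis by (meson ereal_less_eq(3) order_trans)
    qed
  qed
qed

end

section \<open>The tilted random walk stays in a linear tube\<close>

locale random_walk = light_tailed M "X 1" for M :: "'w measure"
  and X :: "nat \<Rightarrow> 'w \<Rightarrow> 'a::euclidean_space" +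
  assumes indep: "indep_vars (\<lambda>_. borel) X {1..}"
    and ident: "\<And>i. i \<ge> 1 \<Longrightarrow> distr M borel (X i) = distr M borel (X 1)"
begin

lemma X_measurable [measurable]: "i \<ge> 1 \<Longrightarrow> X i \<in> borel_measurable M"
  using indep by (auto simp: indep_vars_def)

lemma walk_measurable [measurable]: "walk X n \<in> borel_measurable M"
  unfolding walk_def[abs_def] by (intro borel_measurable_sum) auto

lemma mgf_increment: "i \<ge> 1 \<Longrightarrow> mgf M (X i) \<theta> = mgf M (X 1) \<theta>"
proof -
  assume i: "i \<ge> 1"
  have "mgf M (X k) \<theta> = (\<integral>\<^sup>+x. ennreal (exp (\<theta> \<bullet> x)) \<partial>distr M borel (X k))" if "k \<ge> 1" for k
    using that unfolding mgf_def by (subst nn_integral_distr) auto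
  then show ?thesis using ident[OF i] i by simp
qed

text \<open>The exponent varies with the index because a deviation at time \<open>k\<close> of a
  walk tilted up to time \<open>n\<close> changes the tilting of the first \<open>k\<close>
  increments only.\<close>

lemma nn_integral_exp_sum:
  "(\<integral>\<^sup>+\<omega>. ennreal (exp (\<Sum>i=1..n. t i \<bullet> X i \<omega>)) \<partial>M) = (\<Prod>i=1..n. mgf M (X 1) (t i))"
proof -
  have "indep_vars (\<lambda>_. borel) (\<lambda>i \<omega>. ennreal (exp (t i \<bullet> X i \<omega>))) {1..n}"
    by (rule indep_vars_compose2[OF indep_vars_subset[OF indep]]) auto
  then have "(\<integral>\<^sup>+\<omega>. (\<Prod>i=1..n. ennreal (exp (t i \<bullet> X i \<omega>))) \<partial>M) = (\<Prod>i=1..n. mgf M (X i) (t i))"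
    unfolding mgf_def by (intro indep_vars_nn_integral) auto
  also have "\<dots> = (\<Prod>i=1..n. mgf M (X 1) (t i))" by (intro prod.cong refl mgf_increment) auto
  finally show ?thesis by (simp add: exp_sum prod_ennreal)
qed

lemma nn_integral_exp_walk: "(\<integral>\<^sup>+\<omega>. ennreal (exp (\<theta> \<bullet> walk X n \<omega>)) \<partial>M) = mgf M (X 1) \<theta> ^ n"
  using nn_integral_exp_sum[where t = "\<lambda>_. \<theta>"] by (simp add: walk_def inner_sum_right)

text \<open>An exponential moment of the deviation at time \<open>k\<close> under the tilting by
  \<open>\<theta>\<close> up to time \<open>n\<close>. The factors after \<open>k\<close> equal 1;
  in the first \<open>k\<close> the centring cancels the linear term and leaves the remainder
  \<open>a\<close> per step. The bound is uniform in \<open>k\<close>.\<close>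

lemma chernoff_walk:
  assumes \<theta>: "mgf M (X 1) \<theta> = 1" and k: "k \<le> n"
    and h: "mgf M (X 1) (\<theta> + h) \<le> ennreal (1 + h \<bullet> tmean \<theta> + a)" and a: "0 \<le> a"
  shows "(\<integral>\<^sup>+\<omega>. ennreal (exp (\<theta> \<bullet> walk X n \<omega> + h \<bullet> (walk X k \<omega> - real k *\<^sub>R tmean \<theta>) - c)) \<partial>M)
    \<le> ennreal (exp (real n * a - c))"
proof -
  define t where "t i = (if i \<le> k then \<theta> + h else \<theta>)" for i
  have walk: "\<theta> \<bullet> walk X n \<omega> + h \<bullet> walk X k \<omega> = (\<Sum>i=1..n. t i \<bullet> X i \<omega>)" for \<omega>
  proof -
    have "(\<Sum>i=1..n. t i \<bullet> X i \<omega>) = (\<Sum>i=1..n. \<theta> \<bullet> X i \<omega> + (if i \<in> {1..k} then h \<bullet> X i \<omega> else 0))"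
      by (intro sum.cong) (auto simp: t_def inner_add_left)
    also have "\<dots> = (\<Sum>i=1..n. \<theta> \<bullet> X i \<omega>) + (\<Sum>i\<in>{1..n} \<inter> {1..k}. h \<bullet> X i \<omega>)"
      by (simp only: sum.distrib sum.inter_restrict[OF finite_atLeastAtMost])
    also have "{1..n} \<inter> {1..k} = {1..k}" using k by auto
    finally show ?thesis by (simp add: walk_def inner_sum_right)
  qed
  let ?q = "h \<bullet> tmean \<theta>"
  have split: "\<theta> \<bullet> walk X n \<omega> + h \<bullet> (walk X k \<omega> - real k *\<^sub>R tmean \<theta>) - c
      = (- (real k * ?q) - c) + (\<Sum>i=1..n. t i \<bullet> X i \<omega>)" for \<omega>
    unfolding walk[symmetric] by (simp add: inner_diff_right)
  have "(\<integral>\<^sup>+\<omega>. ennreal (exp (\<theta> \<bullet> walk X n \<omega> + h \<bullet> (walk X k \<omega> - real k *\<^sub>R tmean \<theta>) - c)) \<partial>M)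
      = (\<integral>\<^sup>+\<omega>. ennreal (exp (- (real k * ?q) - c)) * ennreal (exp (\<Sum>i=1..n. t i \<bullet> X i \<omega>)) \<partial>M)"
    by (intro nn_integral_cong) (simp only: split exp_add ennreal_mult'[OF exp_ge_zero])
  also have "\<dots> = ennreal (exp (- (real k * ?q) - c)) * (\<Prod>i=1..n. mgf M (X 1) (t i))"
    unfolding nn_integral_exp_sum[symmetric]
    by (rule nn_integral_cmult) (auto intro!: borel_measurable_sum)
  also have "(\<Prod>i=1..n. mgf M (X 1) (t i)) = (\<Prod>i=1..k. mgf M (X 1) (\<theta> + h))"
    by (rule prod.mono_neutral_cong_right) (use k \<theta> in \<open>auto simp: t_def\<close>)
  also have "\<dots> = mgf M (X 1) (\<theta> + h) ^ k" by simp
  also have "\<dots> \<le> ennreal (exp (?q + a)) ^ k"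
  proof (intro power_mono order_trans[OF h] ennreal_leI)
    show "1 + ?q + a \<le> exp (?q + a)" using exp_ge_add_one_self[of "?q + a"] by linarith
  qed simp
  also have "ennreal (exp (- (real k * ?q) - c)) * ennreal (exp (?q + a)) ^ k = ennreal (exp (real k * a - c))"
    by (simp add: ennreal_power ennreal_mult[symmetric] exp_of_nat_mult[symmetric] exp_add[symmetric] algebra_simps)
  also have "\<dots> \<le> ennreal (exp (real n * a - c))"
    using k a by (intro ennreal_leI) (auto intro: mult_right_mono)
  finally show ?thesis by (simp add: mult_left_mono)
qed

definition tube :: "'a \<Rightarrow> real \<Rightarrow> nat \<Rightarrow> 'w set" where
  "tube v \<epsilon> n = {\<omega> \<in> space M. \<forall>k\<le>n. norm (walk X k \<omega> - real k *\<^sub>R v) \<le> \<epsilon> * real n}"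

lemma tube_events [measurable]: "tube v \<epsilon> n \<in> events"
  unfolding tube_def by measurable

text \<open>The integral is the tilted probability of the tube. Leaving the tube means a large
  coordinate at some \<open>k \<le> n\<close>, and the union bound sums
  \<open>(n + 1) * card H\<close> terms with one common exponential decay.\<close>

lemma eventually_tube_tilted:
  assumes \<theta>: "mgf M (X 1) \<theta> = 1" and \<epsilon>: "0 < \<epsilon>"
  shows "eventually (\<lambda>n. ennreal (1/2) \<le>
    (\<integral>\<^sup>+\<omega>. ennreal (exp (\<theta> \<bullet> walk X n \<omega>)) * indicator (tube (tmean \<theta>) \<epsilon> n) \<omega> \<partial>M)) sequentially"
proof -
  let ?v = "tmean \<theta>"
  have fin: "mgf M (X 1) \<theta> < \<infinity>" using \<theta> by simp
  obtain r K where r: "0 < r" and K: "0 \<le> K" and quad: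
    "\<And>h. norm h \<le> r \<Longrightarrow> mgf M (X 1) (\<theta> + h) \<le> ennreal (1 + h \<bullet> ?v + K * (norm h)\<^sup>2)"
    using mgf_upper_quadratic[OF fin] \<theta> by auto
  \<comment> \<open>The norm is at most the sum of the moduli of the coordinates, so a deviation
    above \<open>\<epsilon> * n\<close> has a coordinate above \<open>d * n\<close>. The signed axis
    directions in \<open>H\<close> detect it.\<close>
  define d where "d = \<epsilon> / DIM('a)"
  have d: "d > 0" using \<epsilon> by (simp add: d_def)
  \<comment> \<open>Within the range of the expansion, and so small that the quadratic loss
    \<open>K * s\<^sup>2\<close> uses at most half of the gain \<open>s * d\<close>.\<close>
  define s where "s = min r (d / (2 * (K + 1)))"
  have s: "s > 0" "s \<le> r" using r d K by (auto simp: s_def)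
  have "s \<le> d / (2 * (K + 1))" by (simp add: s_def)
  then have "s * (2 * (K + 1)) \<le> d" using K by (simp add: pos_le_divide_eq)
  then have "s * (s * (2 * (K + 1))) \<le> s * d" using s by (intro mult_left_mono) auto
  then have Ks: "K * s\<^sup>2 - s * d \<le> - (s * d / 2)" using zero_le_square[of s] by (simp only: algebra_simps power2_eq_square)
  define H where "H = (\<lambda>e. s *\<^sub>R e) ` Basis \<union> (\<lambda>e. (- s) *\<^sub>R e) ` (Basis :: 'a set)"
  have H: "finite H" "\<And>h. h \<in> H \<Longrightarrow> norm h = s" using s by (auto simp: H_def)
  define T where "T n k h \<omega> = exp (\<theta> \<bullet> walk X n \<omega> + h \<bullet> (walk X k \<omega> - real k *\<^sub>R ?v) - s * d * real n)" for n k h \<omega>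
  have [measurable]: "T n k h \<in> borel_measurable M" for n k h
    unfolding T_def[abs_def] by measurable
  have T: "(\<integral>\<^sup>+\<omega>. ennreal (T n k h \<omega>) \<partial>M) \<le> ennreal (exp (- (s * d / 2) * real n))" if "k \<le> n" "h \<in> H" for n k h
  proof -
    have "(\<integral>\<^sup>+\<omega>. ennreal (T n k h \<omega>) \<partial>M) \<le> ennreal (exp (real n * (K * s\<^sup>2) - s * d * real n))"
      unfolding T_def using quad[of h] H(2)[OF that(2)] s K that(1) by (intro chernoff_walk \<theta>) auto
    also have "\<dots> \<le> ennreal (exp (- (s * d / 2) * real n))"
      using mult_right_mono[OF Ks, of "real n"] by (intro ennreal_leI) (simp add: algebra_simps)
    finally show ?thesis .
  qed
  have main: "1 \<le> (\<integral>\<^sup>+\<omega>. ennreal (exp (\<theta> \<bullet> walk X n \<omega>)) * indicator (tube ?v \<epsilon> n) \<omega> \<partial>M)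
      + ennreal ((real n + 1) * real (card H) * exp (- (s * d / 2) * real n))" for n
  proof -
    have pt: "ennreal (exp (\<theta> \<bullet> walk X n \<omega>)) \<le> ennreal (exp (\<theta> \<bullet> walk X n \<omega>)) * indicator (tube ?v \<epsilon> n) \<omega>
        + (\<Sum>k\<le>n. \<Sum>h\<in>H. ennreal (T n k h \<omega>))" if \<omega>: "\<omega> \<in> space M" for \<omega>
    proof (cases "\<omega> \<in> tube ?v \<epsilon> n")
      case False
      then obtain k where k: "k \<le> n" "norm (walk X k \<omega> - real k *\<^sub>R ?v) > \<epsilon> * real n"
        using \<omega> by (auto simp: tube_def not_le)
      have "\<exists>e\<in>Basis. \<bar>(walk X k \<omega> - real k *\<^sub>R ?v) \<bullet> e\<bar> > d * real n"
      proof (rule ccontr)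
        assume "\<not> ?thesis"
        then have "(\<Sum>e\<in>Basis. \<bar>(walk X k \<omega> - real k *\<^sub>R ?v) \<bullet> e\<bar>) \<le> (\<Sum>e\<in>(Basis::'a set). d * real n)"
          by (intro sum_mono) (auto simp: not_less)
        also have "\<dots> = \<epsilon> * real n" by (simp add: d_def)
        finally show False using k(2) norm_le_l1[of "walk X k \<omega> - real k *\<^sub>R ?v"] by linarith
      qed
      then obtain e where e: "e \<in> Basis" "\<bar>(walk X k \<omega> - real k *\<^sub>R ?v) \<bullet> e\<bar> > d * real n" by blast
      obtain h where h: "h \<in> H" "h \<bullet> (walk X k \<omega> - real k *\<^sub>R ?v) = s * \<bar>(walk X k \<omega> - real k *\<^sub>R ?v) \<bullet> e\<bar>"
      proof (cases "(walk X k \<omega> - real k *\<^sub>R ?v) \<bullet> e \<ge> 0")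
        case True
        show thesis by (rule that[of "s *\<^sub>R e"]) (use True e in \<open>auto simp: H_def inner_commute\<close>)
      next
        case False
        show thesis by (rule that[of "(- s) *\<^sub>R e"]) (use False e in \<open>auto simp: H_def inner_commute\<close>)
      qed
      have "s * d * real n \<le> h \<bullet> (walk X k \<omega> - real k *\<^sub>R ?v)"
        using e(2) s(1) unfolding h(2) by (simp add: mult.assoc)
      then have "ennreal (exp (\<theta> \<bullet> walk X n \<omega>)) \<le> ennreal (T n k h \<omega>)"
        unfolding T_def by (intro ennreal_leI) simp
      also have "\<dots> \<le> (\<Sum>h\<in>H. ennreal (T n k h \<omega>))"
        using h(1) H(1) by (intro member_le_sum) auto
      also have "\<dots> \<le> (\<Sum>k\<le>n. \<Sum>h\<in>H. ennreal (T n k h \<omega>))"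
        using k(1) by (intro member_le_sum[of k "{..n}" "\<lambda>k. \<Sum>h\<in>H. ennreal (T n k h \<omega>)"]) auto
      finally show ?thesis by (simp add: add_increasing)
    qed simp
    have "1 = (\<integral>\<^sup>+\<omega>. ennreal (exp (\<theta> \<bullet> walk X n \<omega>)) \<partial>M)" by (simp only: nn_integral_exp_walk \<theta> power_one)
    also have "\<dots> \<le> (\<integral>\<^sup>+\<omega>. ennreal (exp (\<theta> \<bullet> walk X n \<omega>)) * indicator (tube ?v \<epsilon> n) \<omega>
        + (\<Sum>k\<le>n. \<Sum>h\<in>H. ennreal (T n k h \<omega>)) \<partial>M)"
      by (intro nn_integral_mono pt)
    also have "\<dots> = (\<integral>\<^sup>+\<omega>. ennreal (exp (\<theta> \<bullet> walk X n \<omega>)) * indicator (tube ?v \<epsilon> n) \<omega> \<partial>M)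
        + (\<integral>\<^sup>+\<omega>. (\<Sum>k\<le>n. \<Sum>h\<in>H. ennreal (T n k h \<omega>)) \<partial>M)"
      by (rule nn_integral_add) measurable
    also have "(\<integral>\<^sup>+\<omega>. (\<Sum>k\<le>n. \<Sum>h\<in>H. ennreal (T n k h \<omega>)) \<partial>M) = (\<Sum>k\<le>n. \<Sum>h\<in>H. (\<integral>\<^sup>+\<omega>. ennreal (T n k h \<omega>) \<partial>M))"
      by (simp add: nn_integral_sum)
    also have "\<dots> \<le> (\<Sum>k\<le>n. \<Sum>h\<in>H. ennreal (exp (- (s * d / 2) * real n)))"
      using T by (intro sum_mono) auto
    also have "\<dots> = ennreal ((real n + 1) * real (card H) * exp (- (s * d / 2) * real n))"
      by (simp add: ennreal_mult ennreal_of_nat_eq_real_of_nat mult.assoc add.commute)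
    finally show ?thesis by (simp add: add_left_mono)
  qed
  have "eventually (\<lambda>n::nat. (real n + 1) * real (card H) * exp (- (s * d / 2) * real n) < 1/2) sequentially"
  proof (rule order_tendstoD(2)[of _ 0])
    have q: "s * d / 2 > 0" using s d by simp
    define x where "x = exp (- (s * d / 2))"
    have x: "norm x < 1" using q by (simp add: x_def)
    have xn: "exp (- (s * d / 2) * real n) = x ^ n" for n
      by (simp only: x_def exp_of_nat2_mult)
    have "(\<lambda>n. real (card H) * (real n * x ^ n + x ^ n)) \<longlonglongrightarrow> real (card H) * (0 + 0)"
      by (rule tendsto_mult[OF tendsto_const tendsto_add[OF powser_times_n_limit_0[OF x] LIMSEQ_power_zero[OF x]]])
    then show "(\<lambda>n. (real n + 1) * real (card H) * exp (- (s * d / 2) * real n)) \<longlonglongrightarrow> 0"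
      unfolding xn by (simp add: algebra_simps)
  qed simp
  then show ?thesis
  proof eventually_elim
    case (elim n)
    let ?I = "\<integral>\<^sup>+\<omega>. ennreal (exp (\<theta> \<bullet> walk X n \<omega>)) * indicator (tube ?v \<epsilon> n) \<omega> \<partial>M"
    show ?case
    proof (rule ccontr)
      assume "\<not> ennreal (1/2) \<le> ?I"
      then have lt: "?I < ennreal (1/2)" by simp
      then obtain x where x: "?I = ennreal x" "0 \<le> x" by (cases ?I) auto
      have "x < 1/2" using lt unfolding x by (subst (asm) ennreal_less_iff) (use x in auto)
      have "ennreal 1 \<le> ennreal x + ennreal ((real n + 1) * real (card H) * exp (- (s * d / 2) * real n))"
        using main[of n] unfolding x ennreal_1 .
      also have "\<dots> = ennreal (x + (real n + 1) * real (card H) * exp (- (s * d / 2) * real n))"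
        using x by (intro ennreal_plus[symmetric]) auto
      finally show False
        using elim \<open>x < 1/2\<close> x by (subst (asm) ennreal_le_iff) auto
    qed
  qed
qed

text \<open>On the tube \<open>\<theta> \<bullet> walk X n \<omega>\<close> exceeds
  \<open>n * (\<theta> \<bullet> tmean \<theta>)\<close> by at most
  \<open>n * \<epsilon> * norm \<theta>\<close>, which bounds the cost of undoing the
  tilting.\<close>

lemma eventually_prob_tube_ge:
  assumes \<theta>: "mgf M (X 1) \<theta> = 1" and \<epsilon>: "0 < \<epsilon>"
  shows "eventually (\<lambda>n. exp (- real n * (\<theta> \<bullet> tmean \<theta> + \<epsilon> * norm \<theta>)) / 2 \<le> prob (tube (tmean \<theta>) \<epsilon> n)) sequentially"
  using eventually_tube_tilted[OF assms]
proof eventually_elim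
  case (elim n)
  let ?v = "tmean \<theta>"
  let ?c = "\<theta> \<bullet> ?v + \<epsilon> * norm \<theta>"
  have "ennreal (1/2) \<le> (\<integral>\<^sup>+\<omega>. ennreal (exp (\<theta> \<bullet> walk X n \<omega>)) * indicator (tube ?v \<epsilon> n) \<omega> \<partial>M)" by fact
  also have "\<dots> \<le> (\<integral>\<^sup>+\<omega>. ennreal (exp (real n * ?c)) * indicator (tube ?v \<epsilon> n) \<omega> \<partial>M)"
  proof (intro nn_integral_mono)
    fix \<omega>
    show "ennreal (exp (\<theta> \<bullet> walk X n \<omega>)) * indicator (tube ?v \<epsilon> n) \<omega> \<le> ennreal (exp (real n * ?c)) * indicator (tube ?v \<epsilon> n) \<omega>"
    proof (cases "\<omega> \<in> tube ?v \<epsilon> n")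
      case True
      then have le: "norm (walk X n \<omega> - real n *\<^sub>R ?v) \<le> \<epsilon> * real n" by (auto simp: tube_def)
      have "\<theta> \<bullet> (walk X n \<omega> - real n *\<^sub>R ?v) \<le> norm \<theta> * norm (walk X n \<omega> - real n *\<^sub>R ?v)" by (rule norm_cauchy_schwarz)
      also have "\<dots> \<le> norm \<theta> * (\<epsilon> * real n)" using le by (intro mult_left_mono) auto
      finally have "\<theta> \<bullet> walk X n \<omega> \<le> real n * ?c" by (simp add: inner_diff_right algebra_simps)
      then show ?thesis using True by (simp add: ennreal_leI)
    qed simp
  qed
  also have "\<dots> = ennreal (exp (real n * ?c)) * emeasure M (tube ?v \<epsilon> n)"
    by (subst nn_integral_cmult_indicator) auto
  also have "\<dots> = ennreal (exp (real n * ?c) * prob (tube ?v \<epsilon> n))"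
    by (simp add: emeasure_eq_measure ennreal_mult)
  finally have "1 / 2 \<le> exp (real n * ?c) * prob (tube ?v \<epsilon> n)"
    by (subst (asm) ennreal_le_iff) auto
  then have "exp (- (real n * ?c)) * (1 / 2) \<le> exp (- (real n * ?c)) * (exp (real n * ?c) * prob (tube ?v \<epsilon> n))"
    by (intro mult_left_mono) auto
  also have "\<dots> = prob (tube ?v \<epsilon> n)" by (simp only: mult.assoc[symmetric] exp_add[symmetric]) simp
  finally show ?case by simp
qed

end

section \<open>Lower bound for exit probabilities\<close>

text \<open>A deterministic statement. Outside the ball of radius \<open>\<delta> * b\<close> the
  time \<open>k\<close> is at least of order \<open>b\<close>, so a deviation that is a small
  multiple of \<open>b\<close> is also small relative to \<open>k\<close>, and the path points into
  the cone.\<close>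

lemma straight_path_exit:
  fixes V :: "'a::real_normed_vector set"
  assumes "open V" "0 < l" "l *\<^sub>R v \<in> V" "0 < \<delta>"
  obtains \<epsilon>0 b0 where "0 < \<epsilon>0" "0 < b0"
    "\<forall>\<epsilon> b S n. 0 < \<epsilon> \<longrightarrow> \<epsilon> \<le> \<epsilon>0 \<longrightarrow> b0 \<le> b \<longrightarrow> n = nat \<lceil>l * b\<rceil> \<longrightarrow>
        (\<forall>k\<le>n. norm (S k - real k *\<^sub>R v) \<le> \<epsilon> * real n) \<longrightarrow>
        S n \<in> (\<lambda>x. b *\<^sub>R x) ` V \<and> (\<forall>k\<le>n. \<delta> * b \<le> norm (S k) \<longrightarrow> S k \<in> pos_cone V)"
proof -
  obtain \<rho> where \<rho>: "0 < \<rho>" "ball (l *\<^sub>R v) \<rho> \<subseteq> V"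
    using assms(1,3) by (meson open_contains_ball)
  \<comment> \<open>Since \<open>n \<le> (l + 1) * b\<close>, the deviation is at most
    \<open>\<epsilon> * (l + 1) * b\<close>. The first condition turns
    \<open>\<delta> * b \<le> norm (S k)\<close> into
    \<open>\<delta> * b / 2 \<le> k * norm v\<close>; the second spends half of
    \<open>\<rho>\<close> at time \<open>n\<close>; the third brings the deviation rescaled by
    \<open>l / k\<close> below \<open>\<rho>\<close>, in a form that does not divide by
    \<open>norm v\<close>.\<close>
  have "eventually (\<lambda>\<epsilon>. \<epsilon> * (l + 1) < \<delta> / 2) (at_right 0)"
    by (rule order_tendstoD(2)[of _ 0]) (use \<open>0 < \<delta>\<close> in \<open>auto intro!: tendsto_eq_intros\<close>)
  moreover have "eventually (\<lambda>\<epsilon>. \<epsilon> * (l + 1) < \<rho> / 2) (at_right 0)"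
    by (rule order_tendstoD(2)[of _ 0]) (use \<rho> in \<open>auto intro!: tendsto_eq_intros\<close>)
  moreover have "eventually (\<lambda>\<epsilon>. l * (\<epsilon> * (l + 1)) * (2 * norm v) < \<rho> * \<delta>) (at_right 0)"
    by (rule order_tendstoD(2)[of _ 0]) (use \<rho> \<open>0 < \<delta>\<close> in \<open>auto intro!: tendsto_eq_intros\<close>)
  ultimately have "eventually (\<lambda>\<epsilon>. 0 < \<epsilon> \<and> \<epsilon> * (l + 1) < \<delta> / 2 \<and> \<epsilon> * (l + 1) < \<rho> / 2
      \<and> l * (\<epsilon> * (l + 1)) * (2 * norm v) < \<rho> * \<delta>) (at_right 0)"
    using eventually_at_right_less[of 0] by eventually_elim auto
  then obtain \<epsilon>0 where \<epsilon>0: "0 < \<epsilon>0" "\<epsilon>0 * (l + 1) < \<delta> / 2" "\<epsilon>0 * (l + 1) < \<rho> / 2"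
      "l * (\<epsilon>0 * (l + 1)) * (2 * norm v) < \<rho> * \<delta>"
    using eventually_happens[of _ "at_right (0::real)"] by auto
  \<comment> \<open>\<open>b \<ge> 1\<close> absorbs the summand 1 in
    \<open>n \<le> l * b + 1\<close>. The other term lets the displacement caused by rounding, at
    most \<open>norm v\<close>, fit into the second half of \<open>\<rho>\<close>.\<close>
  define b0 where "b0 = max 1 (2 * norm v / \<rho>)"
  show thesis
  proof (rule that[OF \<epsilon>0(1), of b0], goal_cases)
    show "0 < b0" by (simp add: b0_def)
  next
    case 2
    show ?case
    proof (intro allI impI)
    fix \<epsilon> b :: real and S n
    assume \<epsilon>: "0 < \<epsilon>" "\<epsilon> \<le> \<epsilon>0" and b: "b0 \<le> b" and n: "n = nat \<lceil>l * b\<rceil>"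
      and "\<forall>k\<le>n. norm (S k - real k *\<^sub>R v) \<le> \<epsilon> * real n"
    then have S: "\<And>k. k \<le> n \<Longrightarrow> norm (S k - real k *\<^sub>R v) \<le> \<epsilon> * real n" by blast
    have b1: "1 \<le> b" and bv: "2 * norm v / \<rho> \<le> b" using b by (auto simp: b0_def)
    have lb: "l * b > 0" using b1 \<open>0 < l\<close> by simp
    then have n_lo: "l * b \<le> real n" and n_hi: "real n \<le> l * b + 1"
      unfolding n by linarith+
    have "real n \<le> (l + 1) * b" using n_hi b1 by (simp add: algebra_simps)
    then have "\<epsilon> * real n \<le> \<epsilon>0 * ((l + 1) * b)" using \<epsilon> by (intro mult_mono) auto
    then have dev: "\<epsilon> * real n \<le> (\<epsilon>0 * (l + 1)) * b" by (simp add: mult.assoc)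
    have "S n \<in> (\<lambda>x. b *\<^sub>R x) ` V"
    proof
      show "S n = b *\<^sub>R ((1 / b) *\<^sub>R S n)" using b1 by simp
      have "S n - (l * b) *\<^sub>R v = (S n - real n *\<^sub>R v) + (real n - l * b) *\<^sub>R v"
        by (simp add: scaleR_diff_left)
      then have "norm (S n - (l * b) *\<^sub>R v) \<le> norm (S n - real n *\<^sub>R v) + norm ((real n - l * b) *\<^sub>R v)"
        by (metis norm_triangle_ineq)
      also have "\<dots> \<le> (\<epsilon>0 * (l + 1)) * b + 1 * norm v"
      proof (intro add_mono)
        show "norm ((real n - l * b) *\<^sub>R v) \<le> 1 * norm v"
          using n_lo n_hi unfolding norm_scaleR by (intro mult_right_mono) auto
      qed (use S[of n] dev in auto)
      also have "\<dots> < \<rho> / 2 * b + \<rho> / 2 * b"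
      proof (intro add_less_le_mono mult_strict_right_mono \<epsilon>0)
        show "1 * norm v \<le> \<rho> / 2 * b" using bv \<rho> by (simp add: field_simps)
      qed (use b1 in auto)
      finally have "norm (S n - (l * b) *\<^sub>R v) < \<rho> * b" by simp
      moreover have "(1 / b) *\<^sub>R S n - l *\<^sub>R v = (1 / b) *\<^sub>R (S n - (l * b) *\<^sub>R v)"
        using b1 by (simp add: scaleR_diff_right)
      ultimately have "norm ((1 / b) *\<^sub>R S n - l *\<^sub>R v) < \<rho>"
        using b1 by (simp add: pos_divide_less_eq)
      then show "(1 / b) *\<^sub>R S n \<in> V" using \<rho>(2) by (auto simp: dist_norm norm_minus_commute)
    qed
    moreover have "S k \<in> pos_cone V" if k: "k \<le> n" "\<delta> * b \<le> norm (S k)" for k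
    proof -
      have "norm (S k) \<le> norm (S k - real k *\<^sub>R v) + norm (real k *\<^sub>R v)"
        using norm_triangle_ineq[of "S k - real k *\<^sub>R v" "real k *\<^sub>R v"] by simp
      also have "\<dots> \<le> (\<epsilon>0 * (l + 1)) * b + real k * norm v" using S[OF k(1)] dev by simp
      also have "\<dots> \<le> \<delta> / 2 * b + real k * norm v"
        using \<epsilon>0(2) b1 by (intro add_right_mono mult_right_mono) auto
      finally have kv: "\<delta> * b / 2 \<le> real k * norm v" using k(2) by simp
      have "0 < \<delta> * b" using \<open>0 < \<delta>\<close> b1 by simp
      then have kpos: "real k > 0" using kv by (cases k) auto
      \<comment> \<open>The factor that sends \<open>real k *\<^sub>R v\<close> to the centre
        \<open>l *\<^sub>R v\<close> of the ball inside \<open>V\<close>.\<close>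
      define c where "c = l / real k"
      have c: "c > 0" using kpos \<open>0 < l\<close> by (simp add: c_def)
      have "c *\<^sub>R S k - l *\<^sub>R v = c *\<^sub>R (S k - real k *\<^sub>R v)"
        using kpos by (simp add: c_def scaleR_diff_right)
      then have "norm (c *\<^sub>R S k - l *\<^sub>R v) = c * norm (S k - real k *\<^sub>R v)" using c by simp
      also have "\<dots> \<le> c * ((\<epsilon>0 * (l + 1)) * b)" using c S[OF k(1)] dev by (intro mult_left_mono) auto
      also have "\<dots> < \<rho>"
      proof -
        have "l * (\<epsilon>0 * (l + 1) * b) * \<delta> * b \<le> l * (\<epsilon>0 * (l + 1) * b) * (2 * (real k * norm v))"
          using kv \<epsilon>0(1) \<open>0 < l\<close> b1 unfolding mult.assoc[of _ \<delta> b] by (intro mult_left_mono) auto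
        also have "\<dots> = (l * (\<epsilon>0 * (l + 1)) * (2 * norm v)) * (b * real k)" by (simp add: mult_ac)
        also have "\<dots> < (\<rho> * \<delta>) * (b * real k)"
          using \<epsilon>0(4) b1 kpos by (intro mult_strict_right_mono) auto
        finally have "(l * (\<epsilon>0 * (l + 1) * b)) * (\<delta> * b) < (\<rho> * real k) * (\<delta> * b)" by (simp add: mult_ac)
        then have "l * (\<epsilon>0 * (l + 1) * b) < \<rho> * real k"
          using \<open>0 < \<delta> * b\<close> by (rule mult_right_less_imp_less[OF _ less_imp_le])
        then show ?thesis using kpos by (simp add: c_def divide_less_eq)
      qed
      finally have "c *\<^sub>R S k \<in> V" using \<rho>(2) by (auto simp: dist_norm norm_minus_commute)
      moreover have "S k = (1 / c) *\<^sub>R (c *\<^sub>R S k)" "1 / c > 0" using c by simp_all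
      ultimately show ?thesis unfolding pos_cone_def by blast
    qed
    ultimately show "S n \<in> (\<lambda>x. b *\<^sub>R x) ` V \<and> (\<forall>k\<le>n. \<delta> * b \<le> norm (S k) \<longrightarrow> S k \<in> pos_cone V)"
      by blast
    qed
  qed
qed

section \<open>Hitting times as conditions on finitely many steps\<close>

lemma hit_le_iff: "hit X W b j \<omega> \<le> enat n \<longleftrightarrow> (\<exists>k\<le>n. walk X k \<omega> \<in> (\<lambda>x. b *\<^sub>R x) ` W j)"
proof
  let ?A = "{enat n |n. walk X n \<omega> \<in> (\<lambda>x. b *\<^sub>R x) ` W j}"
  assume le: "hit X W b j \<omega> \<le> enat n"
  then have "?A \<noteq> {}" unfolding hit_def Inf_enat_def by (auto split: if_splits)
  then obtain a where "a \<in> ?A" by blast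
  then have "Inf ?A \<in> ?A" using LeastI[of "\<lambda>x. x \<in> ?A" a] unfolding Inf_enat_def by auto
  then show "\<exists>k\<le>n. walk X k \<omega> \<in> (\<lambda>x. b *\<^sub>R x) ` W j" using le unfolding hit_def by auto
next
  assume "\<exists>k\<le>n. walk X k \<omega> \<in> (\<lambda>x. b *\<^sub>R x) ` W j"
  then obtain k where "k \<le> n" "walk X k \<omega> \<in> (\<lambda>x. b *\<^sub>R x) ` W j" by blast
  then have "hit X W b j \<omega> \<le> enat k" unfolding hit_def by (intro Inf_lower) auto
  with \<open>k \<le> n\<close> show "hit X W b j \<omega> \<le> enat n" by (meson enat_ord_simps(1) order_trans)
qed

lemma less_hit_iff: "enat n < hit X W b j \<omega> \<longleftrightarrow> (\<forall>k\<le>n. walk X k \<omega> \<notin> (\<lambda>x. b *\<^sub>R x) ` W j)"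
  using hit_le_iff[of X W b j \<omega> n] by (auto simp: not_le[symmetric])

lemma walk_hit:
  assumes "hit X W b j \<omega> = enat n"
  shows "walk X n \<omega> \<in> (\<lambda>x. b *\<^sub>R x) ` W j"
proof -
  obtain k where k: "k \<le> n" "walk X k \<omega> \<in> (\<lambda>x. b *\<^sub>R x) ` W j"
    using hit_le_iff[of X W b j \<omega> n] assms by auto
  then have "hit X W b j \<omega> \<le> enat k" unfolding hit_le_iff by blast
  with k assms show ?thesis by simp
qed

lemma first_hit_le: "j \<in> {1..J} \<Longrightarrow> first_hit X W J b \<omega> \<le> hit X W b j \<omega>"
  unfolding first_hit_def by (intro Min_le) auto

lemma first_hit_attained:
  assumes "1 \<le> J"
  obtains j where "j \<in> {1..J}" "first_hit X W J b \<omega> = hit X W b j \<omega>"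
proof -
  have "first_hit X W J b \<omega> \<in> (\<lambda>j. hit X W b j \<omega>) ` {1..J}"
    unfolding first_hit_def using assms by (intro Min_in) auto
  then obtain j where "first_hit X W J b \<omega> = hit X W b j \<omega>" "j \<in> {1..J}" by (rule imageE)
  then show thesis by (intro that)
qed

locale exit_problem = random_walk M X
  for M :: "'w measure" and X :: "nat \<Rightarrow> 'w \<Rightarrow> 'a::euclidean_space" +
  fixes W :: "nat \<Rightarrow> 'a set" and J :: nat
  assumes J: "1 \<le> J"
    and open_W: "\<And>j. j \<in> {0..J} \<Longrightarrow> open (W j)"
    and convex_W: "\<And>j. j \<in> {1..J} \<Longrightarrow> convex (W j)"
    and C1: "\<exists>\<delta>>0. \<forall>j\<in>{1..J}. pos_cone (ball (expectation (X 1)) \<delta>) \<inter> W j = {}"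
    and C2: "\<And>j. j \<in> {1..J} \<Longrightarrow>
      interior (pos_cone (edom (legendre (cgf M (X 1))))) \<inter> W j \<noteq> {}"
    and C3_cone: "\<And>j j'. \<lbrakk>j \<in> {0..J}; j' \<in> {0..J}; j \<noteq> j'\<rbrakk> \<Longrightarrow>
      pos_cone (W j) \<inter> pos_cone (W j') = {}"
    and C3_ball: "\<exists>\<delta>>0. \<forall>j\<in>{0..J}. ball 0 \<delta> \<inter> W j = {}"
begin

text \<open>A general index set \<open>D\<close> treats single targets, subfamilies and all targets
  at once, without counting ties twice. The strict inequality excludes paths that miss every target,
  on which all the hitting times agree at infinity.\<close>

definition exit_via :: "real \<Rightarrow> nat set \<Rightarrow> 'w set" where
  "exit_via b D = {\<omega> \<in> space M. first_hit X W J b \<omega> < hit X W b 0 \<omega> \<and>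
     (\<exists>j\<in>D. first_hit X W J b \<omega> = hit X W b j \<omega>)}"

lemma exit_via_all: "exit_via b {1..J} = wrong_exit M X W J b"
proof -
  have "\<exists>j\<in>{1..J}. first_hit X W J b \<omega> = hit X W b j \<omega>" for \<omega>
    using first_hit_attained[OF J, of X W b \<omega>] by metis
  then show ?thesis unfolding exit_via_def wrong_exit_def by auto
qed

lemma tmean_0_nonzero: "tmean 0 \<noteq> 0"
proof -
  obtain \<delta> where "\<delta> > 0" "\<forall>j\<in>{1..J}. pos_cone (ball (expectation (X 1)) \<delta>) \<inter> W j = {}"
    using C1 by blast
  moreover have "1 \<in> {1..J}" using J by simp
  ultimately show ?thesis using C2[of 1] expectation_nonzero[of \<delta> "W 1"] by blast
qed

text \<open>The rate grows at least linearly on the targets by (C1), and the ball of (C3) keeps the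
  targets away from the origin.\<close>

lemma set_rate_pos:
  obtains c where "0 < c" "\<And>j. j \<in> {1..J} \<Longrightarrow> ereal c \<le> set_rate (cgf M (X 1)) (W j)"
proof -
  obtain \<delta> where \<delta>: "\<delta> > 0" "\<forall>j\<in>{1..J}. pos_cone (ball (expectation (X 1)) \<delta>) \<inter> W j = {}"
    using C1 by blast
  obtain d where d: "d > 0" "\<forall>j\<in>{0..J}. ball 0 d \<inter> W j = {}" using C3_ball by blast
  obtain c where c: "0 < c"
    "\<And>x. x \<notin> pos_cone (ball (expectation (X 1)) \<delta>) \<Longrightarrow> ereal (c * norm x) \<le> rate (cgf M (X 1)) x"
    using rate_ge_linear[OF \<delta>(1)] by metis
  show thesis
  proof (rule that[of "c * d"])
    show "0 < c * d" using c d by simp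
    fix j assume j: "j \<in> {1..J}"
    show "ereal (c * d) \<le> set_rate (cgf M (X 1)) (W j)"
      unfolding set_rate_def
    proof (rule INF_greatest)
      fix x assume x: "x \<in> W j"
      have "x \<notin> ball 0 d" using x d(2) j by fastforce
      then have "c * d \<le> c * norm x" using c by simp
      moreover have "x \<notin> pos_cone (ball (expectation (X 1)) \<delta>)" using x \<delta>(2) j by blast
      ultimately show "ereal (c * d) \<le> rate (cgf M (X 1)) x"
        using c(2) by (meson ereal_less_eq(3) order_trans)
    qed
  qed
qed

text \<open>A tube of length about \<open>l * b\<close> has cost about
  \<open>b * l * (\<theta> \<bullet> tmean \<theta>)\<close>; the gap to \<open>b * c\<close> pays
  for the width of the tube, the rounding and the factor 1/2. The measurability hypothesis is
  discharged later by \<open>exit_via_events\<close>.\<close>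

lemma exit_lower_bound:
  assumes j: "j \<in> {1..J}" and c: "set_rate (cgf M (X 1)) (W j) < ereal c"
    and meas: "\<And>b. 0 < b \<Longrightarrow> exit_via b {j} \<in> events"
  shows "eventually (\<lambda>b. exp (- b * c) \<le> prob (exit_via b {j})) at_top"
proof -
  obtain \<delta> where \<delta>: "\<delta> > 0" "\<forall>j\<in>{0..J}. ball 0 \<delta> \<inter> W j = {}" using C3_ball by blast
  have "0 \<notin> W j"
  proof -
    have "(0::'a) \<in> ball 0 \<delta>" using \<delta>(1) by simp
    then show ?thesis using \<delta>(2) j by fastforce
  qed
  then obtain \<theta> l where \<theta>: "mgf M (X 1) \<theta> = 1" "0 < l" "l *\<^sub>R tmean \<theta> \<in> W j" "l * (\<theta> \<bullet> tmean \<theta>) < c"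
    by (rule near_optimal_tilt[OF convex_W[OF j] _ C2[OF j] tmean_0_nonzero c])
  have "open (W j)" using open_W j by simp
  then obtain \<epsilon>0 b0 where \<epsilon>0: "0 < \<epsilon>0" and b0: "0 < b0" and path: 
    "\<forall>\<epsilon> b S n. 0 < \<epsilon> \<longrightarrow> \<epsilon> \<le> \<epsilon>0 \<longrightarrow> b0 \<le> b \<longrightarrow> n = nat \<lceil>l * b\<rceil> \<longrightarrow>
        (\<forall>k\<le>n. norm (S k - real k *\<^sub>R tmean \<theta>) \<le> \<epsilon> * real n) \<longrightarrow>
        S n \<in> (\<lambda>x. b *\<^sub>R x) ` W j \<and> (\<forall>k\<le>n. \<delta> * b \<le> norm (S k) \<longrightarrow> S k \<in> pos_cone (W j))"
    by (rule straight_path_exit[OF _ \<theta>(2,3) \<delta>(1)])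
  have "eventually (\<lambda>\<epsilon>. l * (\<theta> \<bullet> tmean \<theta> + \<epsilon> * norm \<theta>) < c) (at_right 0)"
    by (rule order_tendstoD(2)[of _ "l * (\<theta> \<bullet> tmean \<theta>)"]) (use \<theta>(4) in \<open>auto intro!: tendsto_eq_intros\<close>)
  moreover have "eventually (\<lambda>\<epsilon>. \<epsilon> < \<epsilon>0) (at_right 0)"
    by (rule order_tendstoD(2)[of _ 0]) (use \<epsilon>0 in auto)
  ultimately have "eventually (\<lambda>\<epsilon>. 0 < \<epsilon> \<and> \<epsilon> \<le> \<epsilon>0 \<and> l * (\<theta> \<bullet> tmean \<theta> + \<epsilon> * norm \<theta>) < c) (at_right 0)"
    using eventually_at_right_less[of 0] by eventually_elim auto
  then obtain \<epsilon> where \<epsilon>: "0 < \<epsilon>" "\<epsilon> \<le> \<epsilon>0" "l * (\<theta> \<bullet> tmean \<theta> + \<epsilon> * norm \<theta>) < c"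
    using eventually_happens[of _ "at_right (0::real)"] by auto
  define a where "a = \<theta> \<bullet> tmean \<theta> + \<epsilon> * norm \<theta>"
  have la: "0 < c - l * a" using \<epsilon>(3) by (simp add: a_def)
  have sub: "tube (tmean \<theta>) \<epsilon> (nat \<lceil>l * b\<rceil>) \<subseteq> exit_via b {j}" if b: "b0 \<le> b" for b
  proof
    fix \<omega> assume \<omega>: "\<omega> \<in> tube (tmean \<theta>) \<epsilon> (nat \<lceil>l * b\<rceil>)"
    define n where "n = nat \<lceil>l * b\<rceil>"
    have bpos: "b > 0" using b b0 by simp
    have S: "walk X n \<omega> \<in> (\<lambda>x. b *\<^sub>R x) ` W j"
      "\<And>k. k \<le> n \<Longrightarrow> \<delta> * b \<le> norm (walk X k \<omega>) \<Longrightarrow> walk X k \<omega> \<in> pos_cone (W j)"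
      using path[rule_format, OF \<epsilon>(1,2) b n_def, of "\<lambda>k. walk X k \<omega>"] \<omega> by (auto simp: tube_def n_def)
    have 1: "hit X W b j \<omega> \<le> enat n" using S(1) unfolding hit_le_iff by blast
    \<comment> \<open>The index 0 is included. Inside the ball of radius \<open>\<delta> * b\<close>
      there is no scaled target; outside it the path lies in the cone over \<open>W j\<close>, which
      is disjoint from the cone over \<open>W i\<close>.\<close>
    have 2: "enat n < hit X W b i \<omega>" if i: "i \<in> {0..J}" "i \<noteq> j" for i
      unfolding less_hit_iff
    proof (intro allI impI notI)
      fix k assume k: "k \<le> n" "walk X k \<omega> \<in> (\<lambda>x. b *\<^sub>R x) ` W i"
      then obtain z where z: "z \<in> W i" "walk X k \<omega> = b *\<^sub>R z" by blast
      have "z \<notin> ball 0 \<delta>" using z \<delta>(2) i by blast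
      then have "\<delta> * b \<le> norm (walk X k \<omega>)" using bpos z(2) by simp
      then have "walk X k \<omega> \<in> pos_cone (W j)" using S(2) k by blast
      moreover have "walk X k \<omega> \<in> pos_cone (W i)" using z bpos unfolding pos_cone_def by blast
      moreover have "j \<in> {0..J}" using j by simp
      ultimately show False using C3_cone[of i j] i by blast
    qed
    obtain i where i: "i \<in> {1..J}" "first_hit X W J b \<omega> = hit X W b i \<omega>"
      by (rule first_hit_attained[OF J])
    have "first_hit X W J b \<omega> \<le> enat n" using first_hit_le[OF j, of X W b \<omega>] 1 by (rule order_trans)
    then have "i = j" using 2[of i] i by (metis atLeastAtMost_iff not_le zero_le)
    moreover have "enat n < hit X W b 0 \<omega>" using 2[of 0] j by simp
    ultimately show "\<omega> \<in> exit_via b {j}"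
      using i 1 \<omega> unfolding exit_via_def tube_def by (auto intro: le_less_trans)
  qed
  have lim: "filterlim (\<lambda>b. nat \<lceil>l * b\<rceil>) sequentially at_top"
    unfolding filterlim_at_top
  proof
    fix Z :: nat
    show "eventually (\<lambda>b. Z \<le> nat \<lceil>l * b\<rceil>) at_top"
      using eventually_ge_at_top[of "real Z / l"]
    proof eventually_elim
      case (elim b)
      then have "real Z \<le> l * b" using \<theta>(2) by (simp add: field_simps)
      then show ?case by linarith
    qed
  qed
  have "eventually (\<lambda>b. exp (- real (nat \<lceil>l * b\<rceil>) * a) / 2 \<le> prob (tube (tmean \<theta>) \<epsilon> (nat \<lceil>l * b\<rceil>))) at_top"
    using eventually_compose_filterlim[OF eventually_prob_tube_ge[OF \<theta>(1) \<epsilon>(1)] lim]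
    by (simp add: a_def)
  \<comment> \<open>\<open>\<bar>a\<bar>\<close> pays for rounding \<open>l * b\<close> up to an
    integer, \<open>ln 2\<close> for the factor 1/2.\<close>
  moreover have "eventually (\<lambda>b. (\<bar>a\<bar> + ln 2) / (c - l * a) \<le> b) at_top" by (rule eventually_ge_at_top)
  ultimately show ?thesis
    using eventually_ge_at_top[of b0]
  proof eventually_elim
    case (elim b)
    define n where "n = nat \<lceil>l * b\<rceil>"
    have bpos: "b > 0" using elim b0 by simp
    then have "l * b > 0" using \<theta>(2) by simp
    then have n: "0 \<le> real n - l * b" "real n - l * b \<le> 1" unfolding n_def by linarith+
    have "(real n - l * b) * a \<le> 1 * \<bar>a\<bar>"
      using n by (intro order_trans[OF _ mult_right_mono[OF n(2)]] mult_left_mono) auto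
    moreover have "\<bar>a\<bar> + ln 2 \<le> b * (c - l * a)" using elim(2) la by (simp add: pos_divide_le_eq)
    ultimately have "- b * c \<le> - real n * a - ln 2" by (simp add: algebra_simps)
    then have "exp (- b * c) \<le> exp (- real n * a - ln 2)" by simp
    also have "\<dots> = exp (- real n * a) / 2" by (simp add: exp_diff)
    also have "\<dots> \<le> prob (tube (tmean \<theta>) \<epsilon> n)" using elim(1) by (simp add: n_def)
    also have "\<dots> \<le> prob (exit_via b {j})"
      using sub[OF elim(3)] meas[OF bpos] by (intro finite_measure_mono) (auto simp: n_def)
    finally show ?case .
  qed
qed

end

section \<open>Change of measure at the exit time\<close>

locale importance_sampling = exit_problem M X W J
  for M :: "'w measure" and X :: "nat \<Rightarrow> 'w \<Rightarrow> 'a::euclidean_space" and W J +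
  fixes Q :: "'a \<Rightarrow> 'w measure" and \<Theta> :: "'a set"
  assumes Q: "\<And>\<theta>. \<theta> \<in> \<Theta> \<Longrightarrow> tilted_measure M X \<theta> (Q \<theta>)"
    and \<Theta>: "finite \<Theta>" "\<Theta> \<noteq> {}"
begin

abbreviation "\<F> \<equiv> nat_filtration M X"
abbreviation "Mix \<equiv> mixture M Q \<Theta>"

section \<open>Exit events in the natural filtration\<close>

lemma sets_nat_filtration:
  "sets (\<F> n) = sigma_sets (space M) (\<Union>i\<in>{1..n}. {X i -` A \<inter> space M | A. A \<in> sets borel})"
  unfolding nat_filtration_def by (rule sets_measure_of) auto

lemma space_nat_filtration [simp]: "space (\<F> n) = space M"
  unfolding nat_filtration_def by (rule space_measure_of) auto

lemma subalgebra_nat_filtration: "subalgebra M (\<F> n)"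
  unfolding subalgebra_def sets_nat_filtration
  by (auto intro!: sets.sigma_sets_subset intro: measurable_sets X_measurable)

lemma walk_nat_filtration:
  assumes "k \<le> n"
  shows "walk X k \<in> borel_measurable (\<F> n)"
  unfolding walk_def[abs_def]
proof (intro borel_measurable_sum measurableI)
  fix i A assume "i \<in> {1..k}" "A \<in> sets (borel :: 'a measure)"
  then show "X i -` A \<inter> space (\<F> n) \<in> sets (\<F> n)"
    unfolding sets_nat_filtration using assms by (intro sigma_sets.Basic UN_I[of i]) auto
qed simp

lemma pred_walk_in:
  assumes "k \<le> n" "0 < b" "j \<in> {0..J}"
  shows "Measurable.pred (\<F> n) (\<lambda>\<omega>. walk X k \<omega> \<in> (\<lambda>x. b *\<^sub>R x) ` W j)"
proof -
  have "open ((\<lambda>x. b *\<^sub>R x) ` W j)" using assms open_W by (intro open_scaling) auto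
  then show ?thesis
    using walk_nat_filtration[OF assms(1)] by (intro pred_sets2[of _ borel]) auto
qed

lemma first_hit_le_iff:
  "first_hit X W J b \<omega> \<le> enat n \<longleftrightarrow> (\<exists>j\<in>{1..J}. \<exists>k\<le>n. walk X k \<omega> \<in> (\<lambda>x. b *\<^sub>R x) ` W j)"
proof
  assume *: "first_hit X W J b \<omega> \<le> enat n"
  obtain j where "j \<in> {1..J}" "first_hit X W J b \<omega> = hit X W b j \<omega>"
    by (rule first_hit_attained[OF J])
  with * show "\<exists>j\<in>{1..J}. \<exists>k\<le>n. walk X k \<omega> \<in> (\<lambda>x. b *\<^sub>R x) ` W j"
    unfolding hit_le_iff[symmetric] by metis
next
  assume "\<exists>j\<in>{1..J}. \<exists>k\<le>n. walk X k \<omega> \<in> (\<lambda>x. b *\<^sub>R x) ` W j"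
  then obtain j where "j \<in> {1..J}" "hit X W b j \<omega> \<le> enat n" unfolding hit_le_iff[symmetric] by blast
  then show "first_hit X W J b \<omega> \<le> enat n" by (meson first_hit_le order_trans)
qed

text \<open>Two time indices, because a hit exactly at time \<open>n\<close> is expressed through
  the times \<open>n\<close> and \<open>n - 1\<close> within the same \<open>\<F> n\<close>.\<close>

lemma pred_hit_le:
  assumes "m \<le> n" "0 < b"
  shows "j \<in> {0..J} \<Longrightarrow> Measurable.pred (\<F> n) (\<lambda>\<omega>. hit X W b j \<omega> \<le> enat m)"
    and "Measurable.pred (\<F> n) (\<lambda>\<omega>. first_hit X W J b \<omega> \<le> enat m)"
proof -
  have *: "Measurable.pred (\<F> n) (\<lambda>\<omega>. \<exists>k\<in>{..m}. walk X k \<omega> \<in> (\<lambda>x. b *\<^sub>R x) ` W j)" if "j \<in> {0..J}" for j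
    using assms that by (intro pred_intros_countable_bounded pred_walk_in) auto
  then show "j \<in> {0..J} \<Longrightarrow> Measurable.pred (\<F> n) (\<lambda>\<omega>. hit X W b j \<omega> \<le> enat m)"
    unfolding hit_le_iff Bex_def atMost_iff .
  have "Measurable.pred (\<F> n) (\<lambda>\<omega>. \<exists>j\<in>{1..J}. \<exists>k\<in>{..m}. walk X k \<omega> \<in> (\<lambda>x. b *\<^sub>R x) ` W j)"
    by (intro pred_intros_countable_bounded(4) *) auto
  then show "Measurable.pred (\<F> n) (\<lambda>\<omega>. first_hit X W J b \<omega> \<le> enat m)"
    unfolding first_hit_le_iff Bex_def atMost_iff .
qed

text \<open>The case \<open>n = 0\<close> stands apart since \<open>0 - 1 = 0\<close> on the
  naturals, where the negated condition would contradict the first one.\<close>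

lemma enat_eq_iff_le: "(x :: enat) = enat n \<longleftrightarrow> x \<le> enat n \<and> (n = 0 \<or> \<not> x \<le> enat (n - 1))"
  by (cases x; cases n) auto

text \<open>Slicing by the exit time stands in for the \<sigma>-algebra of a stopping time: on each
  slice the change of measure takes place in a fixed \<open>\<F> n\<close>.\<close>

lemma exit_via_slice:
  assumes "0 < b" "D \<subseteq> {1..J}"
  shows "exit_via b D \<inter> {\<omega>. first_hit X W J b \<omega> = enat n} \<in> sets (\<F> n)"
proof -
  note [measurable] = pred_hit_le[OF _ assms(1)]
  have [measurable]: "Measurable.pred (\<F> n) (\<lambda>\<omega>. \<exists>j\<in>D. hit X W b j \<omega> = enat n)"
  proof (intro pred_intros_countable_bounded(4))
    fix j assume "j \<in> D"
    then have "j \<in> {0..J}" using assms(2) by auto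
    then show "Measurable.pred (\<F> n) (\<lambda>\<omega>. hit X W b j \<omega> = enat n)"
      unfolding enat_eq_iff_le using assms(1) by (intro pred_intros_logic pred_hit_le) auto
  qed
  have [measurable]: "Measurable.pred (\<F> n) (\<lambda>\<omega>. first_hit X W J b \<omega> = enat n)"
    unfolding enat_eq_iff_le using assms(1) by (intro pred_intros_logic pred_hit_le) auto
  have [measurable]: "Measurable.pred (\<F> n) (\<lambda>\<omega>. \<not> hit X W b 0 \<omega> \<le> enat n)"
    using assms(1) by (intro pred_intros_logic pred_hit_le) auto
  have "{\<omega> \<in> space (\<F> n). first_hit X W J b \<omega> = enat n \<and> \<not> hit X W b 0 \<omega> \<le> enat n
      \<and> (\<exists>j\<in>D. hit X W b j \<omega> = enat n)} \<in> sets (\<F> n)" by measurable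
  also have "{\<omega> \<in> space (\<F> n). first_hit X W J b \<omega> = enat n \<and> \<not> hit X W b 0 \<omega> \<le> enat n
      \<and> (\<exists>j\<in>D. hit X W b j \<omega> = enat n)} = exit_via b D \<inter> {\<omega>. first_hit X W J b \<omega> = enat n}"
    unfolding exit_via_def by (auto simp: not_le eq_commute[of "enat n"])
  finally show ?thesis .
qed

lemma exit_via_UN: "exit_via b D = (\<Union>n. exit_via b D \<inter> {\<omega>. first_hit X W J b \<omega> = enat n})"
proof -
  have "\<exists>n. first_hit X W J b \<omega> = enat n" if "\<omega> \<in> exit_via b D" for \<omega>
    using that unfolding exit_via_def by (cases "first_hit X W J b \<omega>") auto
  then show ?thesis by blast
qed

lemma exit_via_events:
  assumes "0 < b" "D \<subseteq> {1..J}"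
  shows "exit_via b D \<in> events"
  using exit_via_slice[OF assms] subalgebra_nat_filtration unfolding subalgebra_def
  by (subst exit_via_UN, intro sets.countable_UN) blast

text \<open>The density of the mixture with respect to \<open>M\<close> on \<open>\<F> n\<close>;
  the weight is its inverse at the exit time.\<close>

definition mix_lr :: "nat \<Rightarrow> 'w \<Rightarrow> real" where
  "mix_lr n \<omega> = 1 / real (card \<Theta>) * (\<Sum>\<theta>\<in>\<Theta>. lr M X \<theta> n \<omega>)"

lemma card_pos: "0 < real (card \<Theta>)"
  using \<Theta> by (simp add: card_gt_0_iff)

lemma mix_lr_pos: "0 < mix_lr n \<omega>"
  unfolding mix_lr_def using \<Theta> card_pos by (intro mult_pos_pos sum_pos) (auto simp: lr_def)

lemma lr_le_mix_lr: "\<theta> \<in> \<Theta> \<Longrightarrow> lr M X \<theta> n \<omega> / real (card \<Theta>) \<le> mix_lr n \<omega>"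
  unfolding mix_lr_def using \<Theta> card_pos member_le_sum[of \<theta> \<Theta> "\<lambda>\<theta>. lr M X \<theta> n \<omega>"]
  by (simp add: divide_right_mono lr_def)

lemma lr_nat_filtration [measurable]: "lr M X \<theta> n \<in> borel_measurable (\<F> n)"
  unfolding lr_def[abs_def] using walk_nat_filtration[of n n] by measurable

lemma mix_lr_nat_filtration [measurable]: "mix_lr n \<in> borel_measurable (\<F> n)"
  unfolding mix_lr_def[abs_def] by measurable

lemma sets_Q: "\<theta> \<in> \<Theta> \<Longrightarrow> sets (Q \<theta>) = sets M"
  using Q by (auto simp: tilted_measure_def)

lemma prob_space_Mix: "prob_space Mix"
proof
  have "emeasure Mix (space Mix) = (\<Sum>\<theta>\<in>\<Theta>. emeasure (Q \<theta>) (space M)) / of_nat (card \<Theta>)"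
    by (subst emeasure_mixture) (auto simp: sets_Q)
  also have "(\<Sum>\<theta>\<in>\<Theta>. emeasure (Q \<theta>) (space M)) = (\<Sum>\<theta>\<in>\<Theta>. 1)"
    using Q unfolding tilted_measure_def by (intro sum.cong) (metis prob_space.emeasure_space_1)+
  also have "\<dots> / of_nat (card \<Theta>) = 1"
    using card_pos by (simp add: ennreal_of_nat_eq_real_of_nat divide_ennreal)
  finally show "emeasure Mix (space Mix) = 1" .
qed

lemma emeasure_Mix_filtration:
  assumes A: "A \<in> sets (\<F> n)"
  shows "emeasure Mix A = (\<integral>\<^sup>+\<omega>\<in>A. ennreal (mix_lr n \<omega>) \<partial>M)"
proof -
  have AM: "A \<in> sets M" using A subalgebra_nat_filtration by (auto simp: subalgebra_def)
  have m: "lr M X \<theta> n \<in> borel_measurable M" for \<theta>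
    by (rule measurable_from_subalg[OF subalgebra_nat_filtration]) measurable
  have "emeasure Mix A = (\<Sum>\<theta>\<in>\<Theta>. emeasure (Q \<theta>) A) / of_nat (card \<Theta>)"
    by (rule emeasure_mixture[OF sets_Q AM])
  also have "(\<Sum>\<theta>\<in>\<Theta>. emeasure (Q \<theta>) A) = (\<Sum>\<theta>\<in>\<Theta>. (\<integral>\<^sup>+\<omega>\<in>A. ennreal (lr M X \<theta> n \<omega>) \<partial>M))"
    using Q A by (intro sum.cong) (auto simp: tilted_measure_def)
  also have "\<dots> = (\<integral>\<^sup>+\<omega>. (\<Sum>\<theta>\<in>\<Theta>. ennreal (lr M X \<theta> n \<omega>) * indicator A \<omega>) \<partial>M)"
    by (intro nn_integral_sum[symmetric] borel_measurable_times_ennreal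
        measurable_compose[OF m measurable_ennreal] borel_measurable_indicator AM)
  also have "\<dots> / of_nat (card \<Theta>) = (\<integral>\<^sup>+\<omega>. (\<Sum>\<theta>\<in>\<Theta>. ennreal (lr M X \<theta> n \<omega>) * indicator A \<omega>) / of_nat (card \<Theta>) \<partial>M)"
    by (intro nn_integral_divide[symmetric] borel_measurable_sum borel_measurable_times_ennreal
        measurable_compose[OF m measurable_ennreal] borel_measurable_indicator AM)
  also have "\<dots> = (\<integral>\<^sup>+\<omega>\<in>A. ennreal (mix_lr n \<omega>) \<partial>M)"
  proof (intro nn_integral_cong)
    fix \<omega>
    have "ennreal (mix_lr n \<omega>) = ennreal ((\<Sum>\<theta>\<in>\<Theta>. lr M X \<theta> n \<omega>) / real (card \<Theta>))" by (simp add: mix_lr_def)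
    also have "\<dots> = ennreal (\<Sum>\<theta>\<in>\<Theta>. lr M X \<theta> n \<omega>) / ennreal (real (card \<Theta>))"
      using card_pos by (intro divide_ennreal[symmetric]) (auto intro: sum_nonneg simp: lr_def)
    also have "\<dots> = (\<Sum>\<theta>\<in>\<Theta>. ennreal (lr M X \<theta> n \<omega>)) / of_nat (card \<Theta>)"
      by (simp add: ennreal_of_nat_eq_real_of_nat lr_def)
    finally show "(\<Sum>\<theta>\<in>\<Theta>. ennreal (lr M X \<theta> n \<omega>) * indicator A \<omega>) / of_nat (card \<Theta>) = ennreal (mix_lr n \<omega>) * indicator A \<omega>"
      by (simp split: split_indicator)
  qed
  finally show ?thesis .
qed

text \<open>The density is known on \<open>\<F> n\<close> only, so the two measures are compared
  after restriction to that subalgebra, where equality on sets extends to measurable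
  functions.\<close>

lemma nn_integral_Mix_filtration:
  assumes f [measurable]: "f \<in> borel_measurable (\<F> n)"
  shows "(\<integral>\<^sup>+\<omega>. f \<omega> \<partial>Mix) = (\<integral>\<^sup>+\<omega>. ennreal (mix_lr n \<omega>) * f \<omega> \<partial>M)"
proof -
  have sub: "subalgebra M (\<F> n)" by (rule subalgebra_nat_filtration)
  then have sub': "subalgebra Mix (\<F> n)" by (simp add: subalgebra_def)
  have eq: "restr_to_subalg Mix (\<F> n) = density (restr_to_subalg M (\<F> n)) (\<lambda>\<omega>. ennreal (mix_lr n \<omega>))"
  proof (rule measure_eqI)
    show "sets (restr_to_subalg Mix (\<F> n)) = sets (density (restr_to_subalg M (\<F> n)) (\<lambda>\<omega>. ennreal (mix_lr n \<omega>)))"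
      by (simp add: sets_restr_to_subalg[OF sub] sets_restr_to_subalg[OF sub'])
    fix A assume "A \<in> sets (restr_to_subalg Mix (\<F> n))"
    then have A: "A \<in> sets (\<F> n)" by (simp add: sets_restr_to_subalg[OF sub'])
    have "emeasure (density (restr_to_subalg M (\<F> n)) (\<lambda>\<omega>. ennreal (mix_lr n \<omega>))) A
        = (\<integral>\<^sup>+\<omega>\<in>A. ennreal (mix_lr n \<omega>) \<partial>restr_to_subalg M (\<F> n))"
      by (rule emeasure_density)
         (auto simp: A sets_restr_to_subalg[OF sub] intro!: measurable_in_subalg[OF sub])
    also have "\<dots> = (\<integral>\<^sup>+\<omega>\<in>A. ennreal (mix_lr n \<omega>) \<partial>M)"
      by (intro nn_integral_subalgebra2[OF sub] borel_measurable_times_ennreal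
          measurable_compose[OF mix_lr_nat_filtration measurable_ennreal] borel_measurable_indicator A)
    also have "\<dots> = emeasure (restr_to_subalg Mix (\<F> n)) A"
      by (simp add: emeasure_restr_to_subalg[OF sub' A] emeasure_Mix_filtration[OF A])
    finally show "emeasure (restr_to_subalg Mix (\<F> n)) A
        = emeasure (density (restr_to_subalg M (\<F> n)) (\<lambda>\<omega>. ennreal (mix_lr n \<omega>))) A" by simp
  qed
  have "(\<integral>\<^sup>+\<omega>. f \<omega> \<partial>Mix) = (\<integral>\<^sup>+\<omega>. f \<omega> \<partial>restr_to_subalg Mix (\<F> n))"
    by (rule nn_integral_subalgebra2[OF sub' f, symmetric])
  also have "\<dots> = (\<integral>\<^sup>+\<omega>. ennreal (mix_lr n \<omega>) * f \<omega> \<partial>restr_to_subalg M (\<F> n))"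
    unfolding eq by (rule nn_integral_density) (auto intro!: measurable_in_subalg[OF sub])
  also have "\<dots> = (\<integral>\<^sup>+\<omega>. ennreal (mix_lr n \<omega>) * f \<omega> \<partial>M)"
    by (rule nn_integral_subalgebra2[OF sub]) measurable
  finally show ?thesis .
qed

section \<open>The importance sampling weight and its moments\<close>

abbreviation "weight \<equiv> IS_weight M X W J \<Theta>"

lemma weight_nonneg: "0 \<le> weight b \<omega>"
  unfolding IS_weight_def
  by (auto intro!: mult_nonneg_nonneg divide_nonneg_nonneg sum_nonneg simp: stopped_lr_def lr_def)

lemma weight_eq:
  assumes "first_hit X W J b \<omega> = enat n" "enat n < hit X W b 0 \<omega>"
  shows "weight b \<omega> = inverse (mix_lr n \<omega>)"
  using assms by (simp add: IS_weight_def stopped_lr_def mix_lr_def)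

text \<open>At each outcome at most one summand is nonzero. The series reduces measurability and the
  change of measure to the slices.\<close>

lemma weight_exit_via_series:
  "ennreal (weight b \<omega>) * indicator (exit_via b D) \<omega> =
    (\<Sum>n. ennreal (inverse (mix_lr n \<omega>)) * indicator (exit_via b D \<inter> {\<omega>. first_hit X W J b \<omega> = enat n}) \<omega>)"
proof (cases "\<omega> \<in> exit_via b D")
  case True
  then obtain n where n: "first_hit X W J b \<omega> = enat n" using exit_via_UN[of b D] by blast
  have "enat n < hit X W b 0 \<omega>" using True n by (simp add: exit_via_def)
  then have w: "weight b \<omega> = inverse (mix_lr n \<omega>)" by (rule weight_eq[OF n])
  have "(\<Sum>k. ennreal (inverse (mix_lr k \<omega>)) * indicator (exit_via b D \<inter> {\<omega>. first_hit X W J b \<omega> = enat k}) \<omega>)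
     = (\<Sum>k\<in>{n}. ennreal (inverse (mix_lr k \<omega>)) * indicator (exit_via b D \<inter> {\<omega>. first_hit X W J b \<omega> = enat k}) \<omega>)"
    by (rule suminf_finite) (auto simp: n)
  then show ?thesis using True by (simp add: n w)
qed simp

lemma weight_exit_via_measurable:
  assumes "0 < b" "D \<subseteq> {1..J}"
  shows "(\<lambda>\<omega>. ennreal (weight b \<omega>) * indicator (exit_via b D) \<omega>) \<in> borel_measurable M"
  unfolding weight_exit_via_series
proof (intro borel_measurable_suminf_order)
  fix n
  note [measurable] = exit_via_slice[OF assms, of n]
  show "(\<lambda>\<omega>. ennreal (inverse (mix_lr n \<omega>)) * indicator (exit_via b D \<inter> {\<omega>. first_hit X W J b \<omega> = enat n}) \<omega>) \<in> borel_measurable M"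
    by (rule measurable_from_subalg[OF subalgebra_nat_filtration[of n]]) measurable
qed

text \<open>Wald's likelihood ratio identity: the likelihood ratio at the exit time cancels the weight.\<close>

lemma weight_unbiased:
  assumes b: "0 < b" "D \<subseteq> {1..J}"
  shows "(\<integral>\<^sup>+\<omega>. ennreal (weight b \<omega>) * indicator (exit_via b D) \<omega> \<partial>Mix) = emeasure M (exit_via b D)"
proof -
  let ?G = "\<lambda>n. exit_via b D \<inter> {\<omega>. first_hit X W J b \<omega> = enat n}"
  have G: "?G n \<in> sets (\<F> n)" for n by (rule exit_via_slice[OF b])
  have GM: "?G n \<in> events" for n using G[of n] subalgebra_nat_filtration by (auto simp: subalgebra_def)
  have mF: "(\<lambda>\<omega>. ennreal (inverse (mix_lr n \<omega>)) * indicator (?G n) \<omega>) \<in> borel_measurable (\<F> n)" for n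
    using G[of n] by measurable
  have mM: "(\<lambda>\<omega>. ennreal (inverse (mix_lr n \<omega>)) * indicator (?G n) \<omega>) \<in> borel_measurable Mix" for n
    using measurable_from_subalg[OF subalgebra_nat_filtration mF] by (simp cong: measurable_cong_sets)
  have "(\<integral>\<^sup>+\<omega>. ennreal (weight b \<omega>) * indicator (exit_via b D) \<omega> \<partial>Mix)
      = (\<Sum>n. \<integral>\<^sup>+\<omega>. ennreal (inverse (mix_lr n \<omega>)) * indicator (?G n) \<omega> \<partial>Mix)"
    unfolding weight_exit_via_series by (rule nn_integral_suminf[OF mM])
  also have "\<dots> = (\<Sum>n. emeasure M (?G n))"
  proof (intro suminf_cong)
    fix n
    have "(\<integral>\<^sup>+\<omega>. ennreal (inverse (mix_lr n \<omega>)) * indicator (?G n) \<omega> \<partial>Mix)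
        = (\<integral>\<^sup>+\<omega>. ennreal (mix_lr n \<omega>) * (ennreal (inverse (mix_lr n \<omega>)) * indicator (?G n) \<omega>) \<partial>M)"
      by (rule nn_integral_Mix_filtration[OF mF])
    also have "\<dots> = (\<integral>\<^sup>+\<omega>. indicator (?G n) \<omega> \<partial>M)"
    proof (intro nn_integral_cong)
      fix \<omega>
      have "ennreal (mix_lr n \<omega>) * ennreal (inverse (mix_lr n \<omega>)) = 1"
        using mix_lr_pos[of n \<omega>] by (simp add: ennreal_mult[symmetric])
      then show "ennreal (mix_lr n \<omega>) * (ennreal (inverse (mix_lr n \<omega>)) * indicator (?G n) \<omega>) = indicator (?G n) \<omega>"
        by (simp add: mult.assoc[symmetric])
    qed
    finally show "(\<integral>\<^sup>+\<omega>. ennreal (inverse (mix_lr n \<omega>)) * indicator (?G n) \<omega> \<partial>Mix) = emeasure M (?G n)"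
      using GM by simp
  qed
  also have "\<dots> = emeasure M (\<Union>n. ?G n)"
    using GM by (intro suminf_emeasure) (auto simp: disjoint_family_on_def)
  finally show ?thesis unfolding exit_via_UN[symmetric] .
qed

lemma second_moment_ge:
  assumes b: "0 < b" "D \<subseteq> {1..J}"
  shows "(emeasure M (exit_via b D))\<^sup>2 \<le> (\<integral>\<^sup>+\<omega>. ennreal ((weight b \<omega>)\<^sup>2) * indicator (exit_via b D) \<omega> \<partial>Mix)"
proof -
  interpret Mix: prob_space Mix by (rule prob_space_Mix)
  let ?f = "\<lambda>\<omega>. ennreal (weight b \<omega>) * indicator (exit_via b D) \<omega>"
  have f: "?f \<in> borel_measurable Mix"
    using weight_exit_via_measurable[OF b] by (simp cong: measurable_cong_sets)
  have "(\<integral>\<^sup>+\<omega>. ?f \<omega> * 1 \<partial>Mix)\<^sup>2 \<le> (\<integral>\<^sup>+\<omega>. (?f \<omega>)\<^sup>2 \<partial>Mix) * (\<integral>\<^sup>+\<omega>. 1\<^sup>2 \<partial>Mix)"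
    by (rule Cauchy_Schwarz_nn_integral[OF f]) simp
  also have "\<dots> = (\<integral>\<^sup>+\<omega>. ennreal ((weight b \<omega>)\<^sup>2) * indicator (exit_via b D) \<omega> \<partial>Mix)"
  proof -
    have "(?f \<omega>)\<^sup>2 = ennreal ((weight b \<omega>)\<^sup>2) * indicator (exit_via b D) \<omega>" for \<omega>
      using weight_nonneg[of b \<omega>] by (simp add: ennreal_power split: split_indicator)
    moreover have "(\<integral>\<^sup>+\<omega>. 1\<^sup>2 \<partial>Mix) = 1" using Mix.emeasure_space_1 by simp
    ultimately show ?thesis by simp
  qed
  finally show ?thesis by (simp add: weight_unbiased[OF b])
qed

text \<open>As the cumulant generating function vanishes at \<open>\<theta>\<close>, the likelihood
  ratio depends on the exit position alone and not on the exit time. Keeping this single term of the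
  average costs the factor \<open>card \<Theta>\<close>.\<close>

lemma weight_le:
  assumes b: "0 < b" and \<theta>: "\<theta> \<in> \<Theta>" "cgf M (X 1) \<theta> = 0" "W j \<subseteq> {v. r \<le> \<theta> \<bullet> v}"
    and j: "first_hit X W J b \<omega> = hit X W b j \<omega>"
  shows "weight b \<omega> \<le> real (card \<Theta>) * exp (- b * r)"
proof (cases "first_hit X W J b \<omega> < hit X W b 0 \<omega>")
  case True
  then obtain n where n: "first_hit X W J b \<omega> = enat n" by (cases "first_hit X W J b \<omega>") auto
  have "walk X n \<omega> \<in> (\<lambda>x. b *\<^sub>R x) ` W j" using j n by (intro walk_hit) simp
  then obtain x where "x \<in> W j" "walk X n \<omega> = b *\<^sub>R x" by blast
  then have "b * r \<le> \<theta> \<bullet> walk X n \<omega>" using \<theta>(3) b by auto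
  then have "exp (b * r) \<le> lr M X \<theta> n \<omega>" unfolding lr_def \<theta>(2) by simp
  then have "exp (b * r) / real (card \<Theta>) \<le> mix_lr n \<omega>"
    using lr_le_mix_lr[OF \<theta>(1), of n \<omega>] card_pos by (meson divide_right_mono less_imp_le order_trans)
  then have "inverse (mix_lr n \<omega>) \<le> inverse (exp (b * r) / real (card \<Theta>))"
    using card_pos by (intro le_imp_inverse_le) auto
  then show ?thesis
    using True by (subst weight_eq[OF n]) (auto simp: n exp_minus field_simps)
qed (simp add: IS_weight_def)

end

section \<open>Asymptotics\<close>

text \<open>The conclusion names a real function \<open>g\<close> with
  \<open>elog (F b) = b * g b\<close> eventually, rather than a limit in \<open>ereal\<close>, so
  that two such logarithms can be divided by real arithmetic.\<close>

lemma elog_rate: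
  fixes F :: "real \<Rightarrow> ennreal"
  assumes K: "0 < K" and up: "eventually (\<lambda>b. F b \<le> ennreal (K * exp (- b * a))) at_top"
    and lo: "\<And>c. a < c \<Longrightarrow> eventually (\<lambda>b. ennreal (exp (- b * c)) \<le> F b) at_top"
  obtains g where "(g \<longlongrightarrow> - a) at_top" "eventually (\<lambda>b. elog (F b) = ereal (b * g b)) at_top"
proof -
  define g where "g b = ln (enn2real (F b)) / b" for b
  have *: "0 < enn2real (F b) \<and> F b = ennreal (enn2real (F b)) \<and> - c \<le> g b \<and> g b \<le> - a + ln K / b"
    if F: "F b \<le> ennreal (K * exp (- b * a))" "ennreal (exp (- b * c)) \<le> F b" and b: "0 < b" for b c
  proof -
    obtain x where x: "F b = ennreal x" "0 \<le> x"
      using F(1) by (cases "F b") (auto simp: top_unique)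
    have 1: "exp (- b * c) \<le> x" "x \<le> K * exp (- b * a)"
      using F x K by auto
    then have pos: "0 < x" by (meson exp_gt_zero less_le_trans)
    have "- b * c \<le> ln x" using 1(1) pos by (simp add: ln_ge_iff)
    moreover have "ln x \<le> ln K - b * a"
      using ln_mono[OF 1(2) pos] K pos by (simp add: ln_mult)
    ultimately show ?thesis using x pos b by (simp add: g_def field_simps)
  qed
  have ev: "eventually (\<lambda>b. elog (F b) = ereal (b * g b) \<and> - c \<le> g b \<and> g b \<le> - a + ln K / b) at_top"
    if "a < c" for c
    using up lo[OF that] eventually_gt_at_top[of 0]
  proof eventually_elim
    case (elim b)
    from *[OF elim] show ?case using elim(3) elog_ennreal[of "enn2real (F b)"] by (auto simp: g_def)
  qed
  have "(g \<longlongrightarrow> - a) at_top"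
  proof (rule order_tendstoI)
    fix y assume y: "y < - a"
    \<comment> \<open>With this \<open>c\<close>, the lower bound \<open>- c\<close> is the midpoint
      of \<open>y\<close> and \<open>- a\<close>, hence above \<open>y\<close>.\<close>
    then have "a < (a - y) / 2" by simp
    from ev[OF this] show "eventually (\<lambda>b. y < g b) at_top"
      by eventually_elim (use y in argo)
  next
    fix y assume y: "- a < y"
    have "((\<lambda>b. - a + ln K / b) \<longlongrightarrow> - a + 0) at_top"
      by (intro tendsto_add tendsto_const tendsto_divide_0[OF tendsto_const]
          filterlim_at_top_imp_at_infinity filterlim_ident)
    then have "eventually (\<lambda>b. - a + ln K / b < y) at_top"
      using y by (intro order_tendstoD(2)) auto
    moreover have "eventually (\<lambda>b. g b \<le> - a + ln K / b) at_top"
      using ev[of "a + 1"] by (auto elim!: eventually_mono)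
    ultimately show "eventually (\<lambda>b. g b < y) at_top"
      by eventually_elim simp
  qed
  moreover have "eventually (\<lambda>b. elog (F b) = ereal (b * g b)) at_top"
    using ev[of "a + 1"] by (auto elim!: eventually_mono)
  ultimately show thesis by (rule that)
qed

context importance_sampling
begin

text \<open>Finiteness from above comes from the optimal tilting: its half-space bounds the rate of
  the set by \<open>\<beta> \<bullet> v\<close> at any point \<open>v\<close> of the nonempty
  \<open>W j\<close>.\<close>

lemma set_rate_finite:
  assumes "j \<in> {1..J}" "optimal_tilting (cgf M (X 1)) (W j) \<beta>"
  obtains r where "set_rate (cgf M (X 1)) (W j) = ereal r" "0 < r"
proof -
  obtain c where c: "0 < c" "ereal c \<le> set_rate (cgf M (X 1)) (W j)"
    using set_rate_pos assms(1) by metis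
  obtain v where "v \<in> W j" using C2[OF assms(1)] by blast
  then have "set_rate (cgf M (X 1)) (W j) \<le> ereal (\<beta> \<bullet> v)"
    using assms(2) by (auto simp: optimal_tilting_def)
  with c show thesis by (cases "set_rate (cgf M (X 1)) (W j)") (auto intro: that)
qed

lemma min_rate_finite:
  assumes "D \<subseteq> {1..J}" "D \<noteq> {}" "\<And>j. j \<in> D \<Longrightarrow> optimal_tilting (cgf M (X 1)) (W j) (\<beta> j)"
  obtains r j where "(MIN j\<in>D. set_rate (cgf M (X 1)) (W j)) = ereal r" "0 < r"
    "j \<in> D" "set_rate (cgf M (X 1)) (W j) = ereal r"
proof -
  have "finite D" using assms(1) finite_subset by blast
  then have "(MIN j\<in>D. set_rate (cgf M (X 1)) (W j)) \<in> (\<lambda>j. set_rate (cgf M (X 1)) (W j)) ` D"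
    using assms(2) by (intro Min_in) auto
  then obtain j where j: "(MIN j\<in>D. set_rate (cgf M (X 1)) (W j)) = set_rate (cgf M (X 1)) (W j)" "j \<in> D"
    by (rule imageE)
  moreover obtain r where "set_rate (cgf M (X 1)) (W j) = ereal r" "0 < r"
    using set_rate_finite[of j "\<beta> j"] assms j(2) by blast
  ultimately show thesis by (intro that[of r j]) auto
qed

lemma weight_le_rate:
  assumes b: "0 < b" and D: "D \<subseteq> {1..J}" "\<And>j. j \<in> D \<Longrightarrow> optimal_tilting (cgf M (X 1)) (W j) (\<beta> j)" "\<beta> ` D \<subseteq> \<Theta>"
    and r: "(MIN j\<in>D. set_rate (cgf M (X 1)) (W j)) = ereal r"
    and j: "j \<in> D" "first_hit X W J b \<omega> = hit X W b j \<omega>"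
  shows "weight b \<omega> \<le> real (card \<Theta>) * exp (- b * r)"
proof (rule weight_le[OF b _ _ _ j(2)])
  show "\<beta> j \<in> \<Theta>" using D j by auto
  show "cgf M (X 1) (\<beta> j) = 0" using D(2)[OF j(1)] by (simp add: optimal_tilting_def)
  have fin: "finite D" using D(1) finite_subset by blast
  have "ereal r \<le> set_rate (cgf M (X 1)) (W j)"
    unfolding r[symmetric] using fin j(1) by (intro Min_le) auto
  then have "ereal r \<le> ereal (\<beta> j \<bullet> v)" if "v \<in> W j" for v
    by (rule order_trans) (use D(2)[OF j(1)] that in \<open>unfold optimal_tilting_def, blast\<close>)
  then show "W j \<subseteq> {v. r \<le> \<beta> j \<bullet> v}" by auto
qed

lemma exit_via_lower_bound:
  assumes D: "D \<subseteq> {1..J}" and j: "j \<in> D" "set_rate (cgf M (X 1)) (W j) = ereal r" and c: "r < c"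
  shows "eventually (\<lambda>b. exp (- b * c) \<le> prob (exit_via b D)) at_top"
proof -
  have "eventually (\<lambda>b. exp (- b * c) \<le> prob (exit_via b {j})) at_top"
    using D j c by (intro exit_lower_bound exit_via_events) auto
  then show ?thesis using eventually_gt_at_top[of 0]
  proof eventually_elim
    case (elim b)
    have "prob (exit_via b {j}) \<le> prob (exit_via b D)"
      using j(1) D elim(2) by (intro finite_measure_mono exit_via_events) (auto simp: exit_via_def)
    with elim(1) show ?case by simp
  qed
qed

text \<open>For the upper bound, unbiasedness writes the probability as the mean of the weight under
  the mixture, and the weight is bounded pointwise. The lower bound is that of a single target of
  minimal rate.\<close>

lemma exit_probability_rate:
  assumes D: "D \<subseteq> {1..J}" "D \<noteq> {}" "\<And>j. j \<in> D \<Longrightarrow> optimal_tilting (cgf M (X 1)) (W j) (\<beta> j)" "\<beta> ` D \<subseteq> \<Theta>"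
    and r: "(MIN j\<in>D. set_rate (cgf M (X 1)) (W j)) = ereal r"
  obtains g where "(g \<longlongrightarrow> - r) at_top"
    "eventually (\<lambda>b. elog (emeasure M (exit_via b D)) = ereal (b * g b)) at_top"
proof (rule elog_rate[of "real (card \<Theta>)"])
  interpret Mix: prob_space Mix by (rule prob_space_Mix)
  show "0 < real (card \<Theta>)" by (rule card_pos)
  show "eventually (\<lambda>b. emeasure M (exit_via b D) \<le> ennreal (real (card \<Theta>) * exp (- b * r))) at_top"
    using eventually_gt_at_top[of 0]
  proof eventually_elim
    case (elim b)
    have "emeasure M (exit_via b D) = (\<integral>\<^sup>+\<omega>. ennreal (weight b \<omega>) * indicator (exit_via b D) \<omega> \<partial>Mix)"
      by (rule weight_unbiased[OF elim D(1), symmetric])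
    also have "\<dots> \<le> (\<integral>\<^sup>+\<omega>. ennreal (real (card \<Theta>) * exp (- b * r)) \<partial>Mix)"
    proof (intro nn_integral_mono)
      fix \<omega>
      show "ennreal (weight b \<omega>) * indicator (exit_via b D) \<omega> \<le> ennreal (real (card \<Theta>) * exp (- b * r))"
      proof (cases "\<omega> \<in> exit_via b D")
        case True
        then obtain j where "j \<in> D" "first_hit X W J b \<omega> = hit X W b j \<omega>" by (auto simp: exit_via_def)
        then have "weight b \<omega> \<le> real (card \<Theta>) * exp (- b * r)"
          using weight_le_rate[OF elim D(1) D(3,4) r] by blast
        then show ?thesis using True by (simp add: ennreal_leI)
      qed simp
    qed
    also have "\<dots> = ennreal (real (card \<Theta>) * exp (- b * r))"
      using Mix.emeasure_space_1 by simp
    finally show ?case .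
  qed
  obtain j where j: "j \<in> D" "set_rate (cgf M (X 1)) (W j) = ereal r"
    using min_rate_finite[OF D(1-3)] r by (metis ereal.inject)
  fix c assume "r < c"
  from exit_via_lower_bound[OF D(1) j this]
  show "eventually (\<lambda>b. ennreal (exp (- b * c)) \<le> emeasure M (exit_via b D)) at_top"
    by eventually_elim (simp add: emeasure_eq_measure)
qed (rule that)

text \<open>The integrand \<open>f\<close> is left open between the squared weight on the exit event
  and a constant multiple of it, so that the sum of indicators, where ties may count several times,
  and the plain second moment are both covered. The constant \<open>N\<close> vanishes on the
  exponential scale.\<close>

lemma second_moment_rate:
  assumes D: "D \<subseteq> {1..J}" "D \<noteq> {}" "\<And>j. j \<in> D \<Longrightarrow> optimal_tilting (cgf M (X 1)) (W j) (\<beta> j)" "\<beta> ` D \<subseteq> \<Theta>"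
    and r: "(MIN j\<in>D. set_rate (cgf M (X 1)) (W j)) = ereal r"
    and N: "0 < N"
    and f_ge: "\<And>b \<omega>. \<omega> \<in> exit_via b D \<Longrightarrow> (weight b \<omega>)\<^sup>2 \<le> f b \<omega>"
    and f_le: "\<And>b \<omega>. f b \<omega> \<le> N * (weight b \<omega>)\<^sup>2 * of_bool (\<exists>j\<in>D. first_hit X W J b \<omega> = hit X W b j \<omega>)"
  obtains g where "(g \<longlongrightarrow> - (2 * r)) at_top"
    "eventually (\<lambda>b. elog (\<integral>\<^sup>+\<omega>. ennreal (f b \<omega>) \<partial>Mix) = ereal (b * g b)) at_top"
proof (rule elog_rate[of "N * (real (card \<Theta>))\<^sup>2"])
  interpret Mix: prob_space Mix by (rule prob_space_Mix)
  show "0 < N * (real (card \<Theta>))\<^sup>2" using N card_pos by simp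
  show "eventually (\<lambda>b. (\<integral>\<^sup>+\<omega>. ennreal (f b \<omega>) \<partial>Mix) \<le> ennreal (N * (real (card \<Theta>))\<^sup>2 * exp (- b * (2 * r)))) at_top"
    using eventually_gt_at_top[of 0]
  proof eventually_elim
    case (elim b)
    have "f b \<omega> \<le> N * (real (card \<Theta>))\<^sup>2 * exp (- b * (2 * r))" for \<omega>
    proof (cases "\<exists>j\<in>D. first_hit X W J b \<omega> = hit X W b j \<omega>")
      case True
      then obtain j where "j \<in> D" "first_hit X W J b \<omega> = hit X W b j \<omega>" by blast
      then have "weight b \<omega> \<le> real (card \<Theta>) * exp (- b * r)"
        using weight_le_rate[OF elim D(1) D(3,4) r] by blast
      then have "(weight b \<omega>)\<^sup>2 \<le> (real (card \<Theta>) * exp (- b * r))\<^sup>2"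
        using weight_nonneg by (rule power_mono)
      also have "\<dots> = (real (card \<Theta>))\<^sup>2 * exp (- b * (2 * r))"
        by (simp add: power_mult_distrib exp_double[symmetric] mult_ac)
      finally have "N * (weight b \<omega>)\<^sup>2 \<le> N * ((real (card \<Theta>))\<^sup>2 * exp (- b * (2 * r)))"
        using N by (intro mult_left_mono) auto
      then show ?thesis using f_le[of b \<omega>] True by simp
    next
      case False
      then have "f b \<omega> \<le> 0" using f_le[of b \<omega>] by simp
      also have "0 \<le> N * (real (card \<Theta>))\<^sup>2 * exp (- b * (2 * r))" using N by simp
      finally show ?thesis .
    qed
    then have "(\<integral>\<^sup>+\<omega>. ennreal (f b \<omega>) \<partial>Mix) \<le> (\<integral>\<^sup>+\<omega>. ennreal (N * (real (card \<Theta>))\<^sup>2 * exp (- b * (2 * r))) \<partial>Mix)"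
      by (intro nn_integral_mono ennreal_leI)
    also have "\<dots> = ennreal (N * (real (card \<Theta>))\<^sup>2 * exp (- b * (2 * r)))"
      using Mix.emeasure_space_1 by simp
    finally show ?case .
  qed
  obtain j where j: "j \<in> D" "set_rate (cgf M (X 1)) (W j) = ereal r"
    using min_rate_finite[OF D(1-3)] r by (metis ereal.inject)
  \<comment> \<open>The exit probability enters squared, so its lower bound is taken with exponent
    \<open>c / 2\<close>.\<close>
  fix c assume "2 * r < c"
  then have "r < c / 2" by simp
  from exit_via_lower_bound[OF D(1) j this]
  show "eventually (\<lambda>b. ennreal (exp (- b * c)) \<le> (\<integral>\<^sup>+\<omega>. ennreal (f b \<omega>) \<partial>Mix)) at_top"
    using eventually_gt_at_top[of 0]
  proof eventually_elim
    case (elim b)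
    have "exp (- b * c) = (exp (- b * (c / 2)))\<^sup>2" by (simp add: exp_double[symmetric])
    also have "\<dots> \<le> (prob (exit_via b D))\<^sup>2" using elim(1) by (intro power_mono) auto
    finally have "ennreal (exp (- b * c)) \<le> (emeasure M (exit_via b D))\<^sup>2"
      by (simp add: emeasure_eq_measure ennreal_power ennreal_leI)
    also have "\<dots> \<le> (\<integral>\<^sup>+\<omega>. ennreal ((weight b \<omega>)\<^sup>2) * indicator (exit_via b D) \<omega> \<partial>Mix)"
      by (rule second_moment_ge[OF elim(2) D(1)])
    also have "\<dots> \<le> (\<integral>\<^sup>+\<omega>. ennreal (f b \<omega>) \<partial>Mix)"
      by (intro nn_integral_mono) (auto split: split_indicator intro: ennreal_leI f_ge)
    finally show ?case .
  qed
qed (rule that)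

end

lemma ereal_scaled_limit:
  assumes "(g \<longlongrightarrow> c) at_top" "eventually (\<lambda>b. F b = ereal (b * g b)) at_top"
  shows "((\<lambda>b. ereal (1 / b) * F b) \<longlongrightarrow> ereal c) at_top"
proof (rule Lim_transform_eventually)
  show "((\<lambda>b. ereal (g b)) \<longlongrightarrow> ereal c) at_top" using assms(1) by (simp add: tendsto_ereal)
  show "eventually (\<lambda>b. ereal (g b) = ereal (1 / b) * F b) at_top"
    using assms(2) eventually_gt_at_top[of 0] by eventually_elim simp
qed

theorem lemma3p3:
  fixes M :: "'w measure"
    and X :: "nat \<Rightarrow> 'w \<Rightarrow> 'a::euclidean_space"
    and J :: nat
    and W :: "nat \<Rightarrow> 'a set"
    and \<beta> :: "nat \<Rightarrow> 'a"
    and Q :: "'a \<Rightarrow> 'w measure"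
    and C :: "nat set"
    and \<Theta> :: "'a set"
  assumes "prob_space M"
    and "prob_space.indep_vars M (\<lambda>_. borel) X {1..}"
    and "\<And>i. i \<ge> 1 \<Longrightarrow> distr M borel (X i) = distr M borel (X 1)"
    and "\<And>j. j \<in> {0..J} \<Longrightarrow> open (W j)"
    and "\<And>j. j \<in> {1..J} \<Longrightarrow> convex (W j)"
    and C1: "\<exists>\<delta>>0. \<forall>j\<in>{1..J}. pos_cone (ball (prob_space.expectation M (X 1)) \<delta>) \<inter> W j = {}"
    and C2: "open (edom (cgf M (X 1)))"
      "\<And>j. j \<in> {1..J} \<Longrightarrow>
         interior (pos_cone (edom (legendre (cgf M (X 1))))) \<inter> W j \<noteq> {}"
    and C3: "\<And>j j'. \<lbrakk>j \<in> {0..J}; j' \<in> {0..J}; j \<noteq> j'\<rbrakk> \<Longrightarrow>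
         pos_cone (W j) \<inter> pos_cone (W j') = {}"
      "\<exists>\<delta>>0. \<forall>j\<in>{0..J}. ball 0 \<delta> \<inter> W j = {}"
    and "\<And>j. j \<in> {1..J} \<Longrightarrow> optimal_tilting (cgf M (X 1)) (W j) (\<beta> j)"
    and "\<And>\<theta>. \<theta> \<in> edom (cgf M (X 1)) \<Longrightarrow> tilted_measure M X \<theta> (Q \<theta>)"
    and "C \<noteq> {}" "C \<subseteq> {1..J}"
    and "finite \<Theta>" "\<Theta> \<subseteq> edom (cgf M (X 1))"
  shows "(\<beta> ` C \<subseteq> \<Theta> \<longrightarrow>
           ((\<lambda>b. ereal (1 / b) *
                elog (\<integral>\<^sup>+\<omega>. ennreal ((IS_weight M X W J \<Theta> b \<omega>)\<^sup>2 *
                        (\<Sum>j\<in>C. of_bool (first_hit X W J b \<omega> = hit X W b j \<omega>)))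
                      \<partial>mixture M Q \<Theta>))
             \<longlongrightarrow> - 2 * (MIN j\<in>C. set_rate (cgf M (X 1)) (W j))) at_top)
       \<and> (\<beta> ` {1..J} \<subseteq> \<Theta> \<longrightarrow>
           Limsup at_top (\<lambda>b. ereal (1 / b) *
                elog (\<integral>\<^sup>+\<omega>. ennreal ((IS_weight M X W J \<Theta> b \<omega>)\<^sup>2) \<partial>mixture M Q \<Theta>))
             \<le> - 2 * (MIN j\<in>{1..J}. set_rate (cgf M (X 1)) (W j))
         \<and> asymptotically_efficient M X W J Q \<Theta>)"
proof -
  interpret prob_space M by fact
  have J: "1 \<le> J" using \<open>C \<noteq> {}\<close> \<open>C \<subseteq> {1..J}\<close> by auto
  have "X 1 \<in> borel_measurable M" using assms(2) by (auto simp: indep_vars_def)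
  have ep: "exit_problem M X W J"
    by (intro exit_problem.intro random_walk.intro light_tailed.intro light_tailed_axioms.intro
        random_walk_axioms.intro exit_problem_axioms.intro) fact+
  \<comment> \<open>Nonemptiness of \<open>\<Theta>\<close> is derived separately from each of the
    two hypotheses on the tiltings.\<close>
  have IS: "importance_sampling M X W J Q \<Theta>" if "\<Theta> \<noteq> {}"
    using ep that \<open>finite \<Theta>\<close> assms(12) \<open>\<Theta> \<subseteq> edom (cgf M (X 1))\<close>
    by (intro importance_sampling.intro importance_sampling_axioms.intro) auto
  have scale: "- 2 * ereal r = ereal (- (2 * r))" for r by (simp add: numeral_eq_ereal)
  have first: "((\<lambda>b. ereal (1 / b) *
                elog (\<integral>\<^sup>+\<omega>. ennreal ((IS_weight M X W J \<Theta> b \<omega>)\<^sup>2 *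
                        (\<Sum>j\<in>C. of_bool (first_hit X W J b \<omega> = hit X W b j \<omega>)))
                      \<partial>mixture M Q \<Theta>))
             \<longlongrightarrow> - 2 * (MIN j\<in>C. set_rate (cgf M (X 1)) (W j))) at_top"
    if \<beta>: "\<beta> ` C \<subseteq> \<Theta>"
  proof -
    have ne: "\<Theta> \<noteq> {}" using \<beta> \<open>C \<noteq> {}\<close> by auto
    interpret importance_sampling M X W J Q \<Theta> by (rule IS[OF ne])
    have fin: "finite C" using \<open>C \<subseteq> {1..J}\<close> finite_subset by blast
    have C: "C \<subseteq> {1..J}" "C \<noteq> {}" "\<And>j. j \<in> C \<Longrightarrow> optimal_tilting (cgf M (X 1)) (W j) (\<beta> j)"
      using assms by auto
    obtain r j where r: "(MIN j\<in>C. set_rate (cgf M (X 1)) (W j)) = ereal r"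
      by (rule min_rate_finite[OF C])
    let ?f = "\<lambda>b \<omega>. (weight b \<omega>)\<^sup>2 * (\<Sum>j\<in>C. of_bool (first_hit X W J b \<omega> = hit X W b j \<omega>))"
    obtain g where "(g \<longlongrightarrow> - (2 * r)) at_top"
      "eventually (\<lambda>b. elog (\<integral>\<^sup>+\<omega>. ennreal (?f b \<omega>) \<partial>Mix) = ereal (b * g b)) at_top"
    proof (rule second_moment_rate[OF C \<beta> r, of "real (card C)" ?f])
      show "0 < real (card C)" using fin C(2) by (simp add: card_gt_0_iff)
    next
      fix b \<omega> assume "\<omega> \<in> exit_via b C"
      then obtain i where i: "i \<in> C" "first_hit X W J b \<omega> = hit X W b i \<omega>" by (auto simp: exit_via_def)
      \<comment> \<open>On the exit event the sum of indicators lies between 1 and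
        \<open>card C\<close>, more than 1 in case of ties.\<close>
      have "(1::real) \<le> (\<Sum>j\<in>C. of_bool (first_hit X W J b \<omega> = hit X W b j \<omega>))"
        using member_le_sum[OF i(1), of "\<lambda>j. of_bool (first_hit X W J b \<omega> = hit X W b j \<omega>) :: real"] fin i(2) by simp
      then show "(weight b \<omega>)\<^sup>2 \<le> ?f b \<omega>" using mult_left_mono[of 1 _ "(weight b \<omega>)\<^sup>2"] by simp
    next
      fix b \<omega>
      have "(\<Sum>j\<in>C. of_bool (first_hit X W J b \<omega> = hit X W b j \<omega>)) \<le>
        real (card C) * of_bool (\<exists>j\<in>C. first_hit X W J b \<omega> = hit X W b j \<omega>)"
        by (rule sum_bounded_above) auto
      from mult_left_mono[OF this, of "(weight b \<omega>)\<^sup>2"]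
      show "?f b \<omega> \<le> real (card C) * (weight b \<omega>)\<^sup>2 * of_bool (\<exists>j\<in>C. first_hit X W J b \<omega> = hit X W b j \<omega>)"
        by (simp add: mult_ac)
    qed
    then show ?thesis unfolding r scale by (rule ereal_scaled_limit)
  qed
  have second: "Limsup at_top (\<lambda>b. ereal (1 / b) *
                elog (\<integral>\<^sup>+\<omega>. ennreal ((IS_weight M X W J \<Theta> b \<omega>)\<^sup>2) \<partial>mixture M Q \<Theta>))
             \<le> - 2 * (MIN j\<in>{1..J}. set_rate (cgf M (X 1)) (W j))
         \<and> asymptotically_efficient M X W J Q \<Theta>"
    if \<beta>: "\<beta> ` {1..J} \<subseteq> \<Theta>"
  proof -
    have D: "{1..J} \<subseteq> {1..J}" "{1..J} \<noteq> {}" "\<And>j. j \<in> {1..J} \<Longrightarrow> optimal_tilting (cgf M (X 1)) (W j) (\<beta> j)"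
      using assms J by auto
    have ne: "\<Theta> \<noteq> {}" using \<beta> D(2) by auto
    interpret importance_sampling M X W J Q \<Theta> by (rule IS[OF ne])
    obtain r j where r: "(MIN j\<in>{1..J}. set_rate (cgf M (X 1)) (W j)) = ereal r" "0 < r"
      by (rule min_rate_finite[OF D])
    \<comment> \<open>This holds also when no target is ever hit: all the hitting times are then
      infinite and equal, while the weight is 0.\<close>
    have attained: "\<exists>j\<in>{1..J}. first_hit X W J b \<omega> = hit X W b j \<omega>" for b \<omega>
      by (rule first_hit_attained[OF J, of X W b \<omega>]) blast
    obtain g where g: "(g \<longlongrightarrow> - (2 * r)) at_top"
      "eventually (\<lambda>b. elog (\<integral>\<^sup>+\<omega>. ennreal ((weight b \<omega>)\<^sup>2) \<partial>Mix) = ereal (b * g b)) at_top"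
      by (rule second_moment_rate[OF D \<beta> r(1), of 1 "\<lambda>b \<omega>. (weight b \<omega>)\<^sup>2"]) (use attained in auto)
    obtain h where h: "(h \<longlongrightarrow> - r) at_top"
      "eventually (\<lambda>b. elog (emeasure M (exit_via b {1..J})) = ereal (b * h b)) at_top"
      by (rule exit_probability_rate[OF D \<beta> r(1)])
    have lim: "((\<lambda>b. ereal (1 / b) * elog (\<integral>\<^sup>+\<omega>. ennreal ((weight b \<omega>)\<^sup>2) \<partial>Mix)) \<longlongrightarrow> - 2 * ereal r) at_top"
      unfolding scale by (rule ereal_scaled_limit[OF g])
    have "asymptotically_efficient M X W J Q \<Theta>"
      unfolding asymptotically_efficient_def
    proof (rule Lim_transform_eventually)
      have "((\<lambda>b. g b / (2 * h b)) \<longlongrightarrow> - (2 * r) / (2 * - r)) at_top"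
        using r(2) by (intro tendsto_intros g h) auto
      then show "((\<lambda>b. ereal (g b / (2 * h b))) \<longlongrightarrow> 1) at_top"
        using r(2) by (simp add: one_ereal_def tendsto_ereal)
      \<comment> \<open>Positivity of \<open>r\<close> makes the denominator eventually nonzero; the
        quotient in \<open>ereal\<close> is then a quotient of reals, in which the factor
        \<open>b\<close> cancels.\<close>
      have "eventually (\<lambda>b. h b < 0) at_top" using h(1) r(2) by (intro order_tendstoD(2)) auto
      with g(2) h(2) eventually_gt_at_top[of 0]
      show "eventually (\<lambda>b. ereal (g b / (2 * h b)) =
          elog (\<integral>\<^sup>+\<omega>. ennreal ((weight b \<omega>)\<^sup>2) \<partial>Mix) / (2 * elog (emeasure M (wrong_exit M X W J b)))) at_top"
      proof eventually_elim
        case (elim b)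
        have "ereal (b * g b) / (2 * ereal (b * h b)) = ereal (b * g b) / ereal (b * (2 * h b))"
          by (simp add: numeral_eq_ereal mult_ac)
        also have "\<dots> = ereal ((b * g b) / (b * (2 * h b)))"
          using elim(3,4) by (subst ereal_divide) simp
        also have "(b * g b) / (b * (2 * h b)) = g b / (2 * h b)" using elim(3) by simp
        finally show ?case unfolding elim(1) elim(2)[unfolded exit_via_all] by (rule sym)
      qed
    qed
    moreover have "Limsup at_top (\<lambda>b. ereal (1 / b) * elog (\<integral>\<^sup>+\<omega>. ennreal ((weight b \<omega>)\<^sup>2) \<partial>Mix)) = - 2 * ereal r"
      using lim by (intro lim_imp_Limsup) auto
    ultimately show ?thesis unfolding r(1) by (simp only: order_refl simp_thms)
  qed
  from first second show ?thesis by blast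
qed

end
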